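(* Let $G$ be a finite undirected graph and $K\subseteq V(G)$ such that $G[K]$ is a complete graph, and let $\mathcal{G}$ be a set of generating faces of $\mathrm{Ind}(G\setminus K)$ such that for each $k\in K$ and each $\sigma\in\mathcal{G}$, some vertex of $\sigma$ is adjacent to $k$. Then \[\mathrm{Ind}(G)\simeq\mathrm{Ind}(G\setminus K)\vee\bigvee_{k\in K}\mathrm{susp}\,\mathrm{Ind}(G\setminus(K\cup N(k))).\] Moreover, let $K'=\{k\in K\mid G\setminus(K\cup N(k))\neq\emptyset\}$ and suppose that $\mathcal{G}_k$ is a set of generating faces of $\mathrm{Ind}(G\setminus(K\cup N(k)))$ for each $k\in K'$. Then the union of \[\mathcal{G},\quad\bigcup_{k\in K\setminus K'}\{\{k\}\},\quad\text{and}\quad\bigcup_{k\in K'}\{\{k\}\cup\sigma\mid\sigma\in\mathcal{G}_k\}\] is a set of generating faces of $\mathrm{Ind}(G)$.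
   Context: $N(v)$ is the set of vertices adjacent to $v$; $G[K]$ is the induced subgraph on $K$; $G\setminus W$ is the induced subgraph on $V(G)\setminus W$. $\mathrm{Ind}(H)$ is the simplicial complex with vertex set $V(H)$ whose simplices are the independent sets of $H$; for the empty graph it is the empty complex. Conventions: $\mathrm{susp}(\emptyset)=S^0$, a wedge over an empty index set is a point. A set $\mathcal{G}$ of maximal faces of a simplicial complex $\Delta$ is a set of generating faces if the complex $\Delta\setminus\mathcal{G}$ obtained by removing the faces in $\mathcal{G}$ is contractible (then $\Delta\simeq\bigvee_{\sigma\in\mathcal{G}}S^{\dim\sigma}$). *)

theory Defs
  imports "HOL-Analysis.Analysis"
begin

text \<open>Abstract simplicial complexes are represented as sets of finite vertex sets.
  The geometric realization of a (finite) complex is the set of functions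
  f :: 'v => real that are barycentric coordinates of a point in some face,
  with the subspace topology of the product (here: finite-dimensional
  Euclidean) topology.\<close>

definition realization :: "'v set set \<Rightarrow> ('v \<Rightarrow> real) topology" where
  "realization \<Delta> = top_of_set
     {f. (\<forall>v. 0 \<le> f v) \<and> (\<exists>\<sigma>\<in>\<Delta>. finite \<sigma> \<and> (\<forall>v. v \<notin> \<sigma> \<longrightarrow> f v = 0) \<and> sum f \<sigma> = 1)}"

text \<open>Graphs: finite vertex set V with a symmetric irreflexive adjacency E.
  Induced subgraphs are given by a vertex subset W, with the same E.
  The independence complex of the graph induced on W:\<close>

definition ind_cx :: "'a set \<Rightarrow> ('a \<Rightarrow> 'a \<Rightarrow> bool) \<Rightarrow> 'a set set" where
  "ind_cx W E = {\<sigma>. \<sigma> \<subseteq> W \<and> (\<forall>x\<in>\<sigma>. \<forall>y\<in>\<sigma>. \<not> E x y)}"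

definition nbhd :: "'a set \<Rightarrow> ('a \<Rightarrow> 'a \<Rightarrow> bool) \<Rightarrow> 'a \<Rightarrow> 'a set" where
  "nbhd V E v = {u\<in>V. E v u}"

definition facet :: "'v set set \<Rightarrow> 'v set \<Rightarrow> bool" where
  "facet \<Delta> \<sigma> \<longleftrightarrow> \<sigma> \<in> \<Delta> \<and> (\<forall>\<tau>\<in>\<Delta>. \<sigma> \<subseteq> \<tau> \<longrightarrow> \<tau> = \<sigma>)"

definition generating_faces :: "'v set set \<Rightarrow> 'v set set \<Rightarrow> bool" where
  "generating_faces \<Delta> \<G> \<longleftrightarrow>
     (\<forall>\<sigma>\<in>\<G>. facet \<Delta> \<sigma>) \<and>
     topspace (realization (\<Delta> - \<G>)) \<noteq> {} \<and> contractible_space (realization (\<Delta> - \<G>))"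

text \<open>Simplicial (unreduced) suspension: join with the two-point complex S^0.
  susp_cx {{}} is S^0, matching the convention susp(empty) = S^0.\<close>

definition susp_cx :: "'v set set \<Rightarrow> ('v + bool) set set" where
  "susp_cx \<Delta> = {Inl ` \<sigma> \<union> T | \<sigma> T. \<sigma> \<in> \<Delta> \<and> T \<in> {{}, {Inr True}, {Inr False}}}"

text \<open>Simplicial wedge of the complexes \<Delta> i (i in I) at the base vertices b i:
  disjoint union with all base vertices identified to the single vertex None.
  The wedge over an empty index set is a point.\<close>

definition wedge_cx :: "'i set \<Rightarrow> ('i \<Rightarrow> 'v set set) \<Rightarrow> ('i \<Rightarrow> 'v) \<Rightarrow> ('i \<times> 'v) option set set" where
  "wedge_cx I \<Delta> b = {{}, {None}} \<union>
     (\<Union>i\<in>I. (\<lambda>\<sigma>. (\<lambda>v. if v = b i then None else Some (i, v)) ` \<sigma>) ` \<Delta> i)"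

end

theory Submission
  imports Defs
begin

text \<open>Since \<open>K\<close> spans a complete graph, a simplex of \<open>Ind(G)\<close> contains at most one vertex of \<open>K\<close>, so
  \<open>Ind(G)\<close> is \<open>Ind(G - K)\<close> with, for every \<open>k \<in> K\<close>, a cone with apex \<open>k\<close> attached along
  \<open>L k = Ind(G - (K \<union> N(k)))\<close>. The adjacency hypothesis says that each \<open>L k\<close> lies in the contractible
  complex \<open>Ind(G - K) - \<G>\<close>, so its inclusion is homotopic to a constant map. Attaching cones along
  homotopic maps gives homotopy equivalent spaces, and along constant maps it gives a wedge of
  suspensions. Removing the proposed faces leaves the contractible base \<open>Ind(G - K) - \<G>\<close> with cones
  over the contractible \<open>L k - \<G>\<^sub>k\<close>, and such a space is contractible.\<close>

section \<open>Gluing continuous maps over compact pieces\<close>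

text \<open>The difficulty is continuity rather than combinatorics: the homotopies are given by
  formulas in the height above a point, and these descend to the space only if they agree where the
  pieces meet. Every piece is compact and the space is Hausdorff, so the parametrizations are
  quotient maps and agreement is all that has to be checked. This is done once, in the locale
  \<open>cone_attachment\<close>, which is used for three spaces: \<open>Ind(G)\<close>, the wedge
  of suspensions, and what remains of \<open>Ind(G)\<close> after the removal. The first two share
  the base and all \<open>L k\<close> and differ only in the attaching maps. The suspension of
  \<open>L k\<close> becomes a single cone by taking one of its poles as the wedge point: it is the
  cone from the other pole with its bottom collapsed. A degenerate case runs through the proof: if
  \<open>G - (K \<union> N(k))\<close> is empty, the realization of \<open>L k\<close> is empty, its
  suspension is two points and the cone is an isolated apex. Hence apexes are separate data, and the
  faces \<open>{k}\<close> with \<open>k \<in> K - K'\<close> have to be removed.\<close>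

lemma Hausdorff_euclidean_fun: "Hausdorff_space (euclidean :: ('v \<Rightarrow> real) topology)"
  unfolding euclidean_product_topology[symmetric] by (simp add: Hausdorff_space_product_topology)

lemma Hausdorff_euclidean_Times:
  assumes "Hausdorff_space (euclidean :: 'x::topological_space topology)"
  shows "Hausdorff_space (euclidean :: (real \<times> 'x) topology)"
proof -
  have "Hausdorff_space (prod_topology (euclidean :: real topology) (euclidean :: 'x topology))"
    using assms by (simp add: Hausdorff_space_prod_topology del: prod_topology_euclidean)
  then show ?thesis by (simp only: prod_topology_euclidean)
qed

lemma compact_imp_closed_T2:
  assumes "Hausdorff_space (euclidean :: 'x::topological_space topology)" "compact (C :: 'x set)"
  shows "closed C"
  using compactin_imp_closedin[OF assms(1), of C] assms(2) by simp

text \<open>A continuous map from a compact space to a Hausdorff space is closed, so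
  \<open>q\<close> is a quotient map onto its image: a closed preimage in \<open>S\<close> is
  compact, and its image is closed again.\<close>

lemma continuous_on_compact_quotient:
  fixes q :: "'s::topological_space \<Rightarrow> 'x::topological_space" and F :: "'x \<Rightarrow> 'z::topological_space"
  assumes T2: "Hausdorff_space (euclidean :: 'x topology)"
    and "compact S" "continuous_on S q" "continuous_on S (\<lambda>s. F (q s))"
  shows "continuous_on (q ` S) F"
  unfolding continuous_on_closed_invariant
proof (intro allI impI)
  fix C :: "'z set"
  assume "closed C"
  then obtain A where A: "closed A" "A \<inter> S = (\<lambda>s. F (q s)) -` C \<inter> S"
    using assms(4) unfolding continuous_on_closed_invariant by blast
  have "compact (q ` (A \<inter> S))"
    using assms A(1) by (intro compact_continuous_image) (auto intro: continuous_on_subset closed_Int_compact)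
  then show "\<exists>A. closed A \<and> A \<inter> q ` S = F -` C \<inter> q ` S"
    using A(2) by (intro exI[of _ "q ` (A \<inter> S)"]) (auto dest: compact_imp_closed_T2[OF T2])
qed

text \<open>The finitely many images are closed, so continuity may be checked on each of them, where
  it is inherited through the parametrization \<open>q j\<close>. \<open>compat\<close> is
  well-definedness, both within a piece and between pieces.\<close>

lemma glue_compact_pieces:
  fixes q :: "'j \<Rightarrow> 's::topological_space \<Rightarrow> 'x::topological_space" and G :: "'j \<Rightarrow> 's \<Rightarrow> 'z::topological_space"
  assumes T2: "Hausdorff_space (euclidean :: 'x topology)"
    and "finite J" and comp: "\<And>j. j \<in> J \<Longrightarrow> compact (S j)"
    and q: "\<And>j. j \<in> J \<Longrightarrow> continuous_on (S j) (q j)"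
    and G: "\<And>j. j \<in> J \<Longrightarrow> continuous_on (S j) (G j)"
    and compat: "\<And>j j' s s'. \<lbrakk>j \<in> J; j' \<in> J; s \<in> S j; s' \<in> S j'; q j s = q j' s'\<rbrakk> \<Longrightarrow> G j s = G j' s'"
  shows "\<exists>F. continuous_on (\<Union>j\<in>J. q j ` S j) F \<and> (\<forall>j\<in>J. \<forall>s\<in>S j. F (q j s) = G j s)"
proof -
  have "\<forall>y. \<exists>z. \<forall>j\<in>J. \<forall>s\<in>S j. q j s = y \<longrightarrow> G j s = z"
    using compat by metis
  then obtain F where F: "\<And>j s. \<lbrakk>j \<in> J; s \<in> S j\<rbrakk> \<Longrightarrow> F (q j s) = G j s"
    by metis
  have "continuous_on (\<Union>j\<in>J. q j ` S j) F"
  proof (rule continuous_on_closed_Union)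
    fix j assume j: "j \<in> J"
    show "closed (q j ` S j)"
      using comp q j by (intro compact_imp_closed_T2[OF T2] compact_continuous_image)
    have "continuous_on (S j) (\<lambda>s. F (q j s))"
      using G[OF j] by (rule continuous_on_eq) (simp add: F j)
    then show "continuous_on (q j ` S j) F"
      using comp q j by (intro continuous_on_compact_quotient[OF T2])
  qed (fact \<open>finite J\<close>)
  then show ?thesis using F by blast
qed

lemma homotopic_with_canonI:
  assumes cont: "continuous_on ({0..1::real} \<times> S) h" and T: "\<And>u x. \<lbrakk>u \<in> {0..1}; x \<in> S\<rbrakk> \<Longrightarrow> h (u, x) \<in> T"
    and p: "\<And>x. x \<in> S \<Longrightarrow> h (0, x) = p x" and r: "\<And>x. x \<in> S \<Longrightarrow> h (1, x) = r x"
  shows "homotopic_with_canon (\<lambda>_. True) S T p r"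
proof -
  \<comment> \<open>\<open>homotopic_with_def\<close> prescribes the end maps at every point of the
    type, so \<open>h\<close> has to be overwritten outside \<open>S\<close>.\<close>
  define h' where "h' = (\<lambda>y. if snd y \<in> S then h y else if fst y = 0 then p (snd y) else r (snd y))"
  have "continuous_on ({0..1} \<times> S) h'"
    using cont by (rule continuous_on_eq) (auto simp: h'_def)
  moreover have "h' \<in> {0..1} \<times> S \<rightarrow> T"
    using T by (auto simp: h'_def)
  ultimately have "continuous_map (prod_topology (top_of_set {0..1}) (top_of_set S)) (top_of_set T) h'"
    by simp
  moreover have "\<forall>x. h' (0, x) = p x" "\<forall>x. h' (1, x) = r x"
    using p r by (simp_all add: h'_def)
  ultimately show ?thesis
    unfolding homotopic_with_def by blast
qed

text \<open>A contractible space contracts to any of its points. The end point is left free because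
  the main proof needs it to be a chosen vertex, the one that serves as wedge point.\<close>

lemma contractible_homotopy:
  assumes "contractible S" "a \<in> S"
  shows "\<exists>H. continuous_on ({0..1::real} \<times> S) H \<and> H \<in> {0..1} \<times> S \<rightarrow> S \<and>
    (\<forall>x. H (0, x) = x) \<and> (\<forall>x. H (1, x) = a)"
proof -
  have "contractible_space (top_of_set S)" "a \<in> topspace (top_of_set S)"
    using assms by simp_all
  then have "homotopic_with_canon (\<lambda>_. True) S S id (\<lambda>_. a)"
    unfolding contractible_space_alt by blast
  then obtain H where H: "continuous_map (prod_topology (top_of_set {0..1::real}) (top_of_set S)) (top_of_set S) H"
    "\<forall>x. H (0, x) = id x" "\<forall>x. H (1, x) = a"
    unfolding homotopic_with_def by blast
  have "continuous_on ({0..1} \<times> S) H" "H \<in> {0..1} \<times> S \<rightarrow> S"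
    using H(1) by simp_all
  with H(2,3) show ?thesis
    unfolding id_apply by blast
qed

section \<open>Attaching cones along maps\<close>

text \<open>\<open>X\<close> is \<open>B\<close> with a cone on each \<open>L k\<close> attached along \<open>f k\<close>: \<open>c k x t\<close> is the point at
  height \<open>t\<close> above \<open>x\<close>, and \<open>a k\<close> is the apex, which is present even if \<open>L k\<close> is empty.\<close>

locale cone_attachment =
  fixes B :: "'b::topological_space set" and I :: "'k set" and L :: "'k \<Rightarrow> 'b set"
    and f :: "'k \<Rightarrow> 'b \<Rightarrow> 'b" and X :: "'x::topological_space set" and i :: "'b \<Rightarrow> 'x"
    and c :: "'k \<Rightarrow> 'b \<Rightarrow> real \<Rightarrow> 'x" and a :: "'k \<Rightarrow> 'x"
  assumes T2: "Hausdorff_space (euclidean :: 'x topology)"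
    and finite_I: "finite I" and compact_B: "compact B"
    and compact_L: "\<And>k. k \<in> I \<Longrightarrow> compact (L k)"
    and cont_f: "\<And>k. k \<in> I \<Longrightarrow> continuous_on (L k) (f k)"
    and f_in: "\<And>k x. k \<in> I \<Longrightarrow> x \<in> L k \<Longrightarrow> f k x \<in> B"
    and cont_i: "continuous_on B i"
    and cont_c: "\<And>k. k \<in> I \<Longrightarrow> continuous_on (L k \<times> {0..1}) (\<lambda>(x, t). c k x t)"
    and c_0: "\<And>k x. k \<in> I \<Longrightarrow> x \<in> L k \<Longrightarrow> c k x 0 = i (f k x)"
    and c_1: "\<And>k x. k \<in> I \<Longrightarrow> x \<in> L k \<Longrightarrow> c k x 1 = a k"
    and X_eq: "X = i ` B \<union> (\<Union>k\<in>I. insert (a k) (\<Union>x\<in>L k. c k x ` {0..1}))"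
    and inj_i: "inj_on i B"
    and a_base: "\<And>k b. k \<in> I \<Longrightarrow> b \<in> B \<Longrightarrow> a k \<noteq> i b"
    and c_base: "\<And>k x t b. k \<in> I \<Longrightarrow> x \<in> L k \<Longrightarrow> t \<in> {0..1} \<Longrightarrow> b \<in> B \<Longrightarrow> c k x t = i b \<Longrightarrow> t = 0"
    and inj_a: "inj_on a I"
    and c_apex: "\<And>k x t k'. k \<in> I \<Longrightarrow> x \<in> L k \<Longrightarrow> t \<in> {0..1} \<Longrightarrow> k' \<in> I \<Longrightarrow> c k x t = a k' \<Longrightarrow> k = k' \<and> t = 1"
    and inj_c: "\<And>k x t k' x' t'. k \<in> I \<Longrightarrow> x \<in> L k \<Longrightarrow> t \<in> {0<..<1} \<Longrightarrow> k' \<in> I \<Longrightarrow> x' \<in> L k' \<Longrightarrow> t' \<in> {0<..<1} \<Longrightarrow>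
      c k x t = c k' x' t' \<Longrightarrow> k = k' \<and> x = x' \<and> t = t'"
begin

lemma i_in: "b \<in> B \<Longrightarrow> i b \<in> X"
  and a_in: "k \<in> I \<Longrightarrow> a k \<in> X"
  and c_in: "\<lbrakk>k \<in> I; x \<in> L k; t \<in> {0..1}\<rbrakk> \<Longrightarrow> c k x t \<in> X"
  unfolding X_eq by blast+

lemma X_cases [consumes 1, case_names base apex cone]:
  assumes "y \<in> X"
  obtains b where "b \<in> B" "y = i b" | k where "k \<in> I" "y = a k"
    | k x t where "k \<in> I" "x \<in> L k" "t \<in> {0..1}" "y = c k x t"
  using assms unfolding X_eq by auto

text \<open>The universal property of \<open>X\<close>, with a time parameter built in: a homotopy
  on the base and one on each cone that agrees with it at height 0 and forgets \<open>x\<close> at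
  height 1. The apex needs its own path \<gamma> because \<beta> says nothing about it when
  \<open>L k\<close> is empty. Crossing with the unit interval keeps the pieces compact, so no
  theorem on products of quotient maps enters.\<close>

lemma extend_homotopy:
  fixes \<alpha> :: "real \<Rightarrow> 'b \<Rightarrow> 'z::topological_space"
  assumes \<alpha>: "continuous_on ({0..1} \<times> B) (\<lambda>(u, b). \<alpha> u b)"
    and \<beta>: "\<And>k. k \<in> I \<Longrightarrow> continuous_on ({0..1} \<times> L k \<times> {0..1}) (\<lambda>(u, x, t). \<beta> k u x t)"
    and \<gamma>: "\<And>k. k \<in> I \<Longrightarrow> continuous_on {0..1} (\<gamma> k)"
    and \<beta>0: "\<And>k u x. \<lbrakk>k \<in> I; u \<in> {0..1}; x \<in> L k\<rbrakk> \<Longrightarrow> \<beta> k u x 0 = \<alpha> u (f k x)"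
    and \<beta>1: "\<And>k u x. \<lbrakk>k \<in> I; u \<in> {0..1}; x \<in> L k\<rbrakk> \<Longrightarrow> \<beta> k u x 1 = \<gamma> k u"
    and \<alpha>Z: "\<And>u b. \<lbrakk>u \<in> {0..1}; b \<in> B\<rbrakk> \<Longrightarrow> \<alpha> u b \<in> Z"
    and \<beta>Z: "\<And>k u x t. \<lbrakk>k \<in> I; u \<in> {0..1}; x \<in> L k; t \<in> {0..1}\<rbrakk> \<Longrightarrow> \<beta> k u x t \<in> Z"
    and \<gamma>Z: "\<And>k u. \<lbrakk>k \<in> I; u \<in> {0..1}\<rbrakk> \<Longrightarrow> \<gamma> k u \<in> Z"
  shows "\<exists>F. continuous_on ({0..1} \<times> X) F \<and> (\<forall>u\<in>{0..1}. (\<forall>y\<in>X. F (u, y) \<in> Z) \<and>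
      (\<forall>b\<in>B. F (u, i b) = \<alpha> u b) \<and>
      (\<forall>k\<in>I. F (u, a k) = \<gamma> k u \<and> (\<forall>x\<in>L k. \<forall>t\<in>{0..1}. F (u, c k x t) = \<beta> k u x t)))"
proof -
  \<comment> \<open>The gluing lemma wants one parameter type. \<open>None\<close> stands for the
    base, \<open>Some k\<close> with flag \<open>True\<close> for the cone and with
    \<open>False\<close> for the bare apex. Coordinates that a piece does not use are frozen to a
    single value, and the flag beside \<open>None\<close> is a filler.\<close>
  define J where "J = insert (None, True) (Some ` I \<times> (UNIV :: bool set))"
  define S :: "'k option \<times> bool \<Rightarrow> (real \<times> 'b \<times> real) set" where
    "S = (\<lambda>(m, p). {0..1} \<times> (case m of None \<Rightarrow> B \<times> {0} | Some k \<Rightarrow> if p then L k \<times> {0..1} else {undefined} \<times> {1}))"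
  define q :: "'k option \<times> bool \<Rightarrow> real \<times> 'b \<times> real \<Rightarrow> real \<times> 'x" where
    "q = (\<lambda>(m, p) (u, x, t). (u, case m of None \<Rightarrow> i x | Some k \<Rightarrow> if p then c k x t else a k))"
  define G :: "'k option \<times> bool \<Rightarrow> real \<times> 'b \<times> real \<Rightarrow> 'z" where
    "G = (\<lambda>(m, p) (u, x, t). case m of None \<Rightarrow> \<alpha> u x | Some k \<Rightarrow> if p then \<beta> k u x t else \<gamma> k u)"
  have J_cases: "P j" if "j \<in> J" "P (None, True)" "\<And>k. k \<in> I \<Longrightarrow> P (Some k, True)"
    "\<And>k. k \<in> I \<Longrightarrow> P (Some k, False)" for P j
    using that unfolding J_def by (cases j; cases "snd j") auto
  have "finite J" unfolding J_def using finite_I by simp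
  moreover have "compact (S j)" if "j \<in> J" for j
    using that
  proof (rule J_cases[where P = "\<lambda>j. compact (S j)"])
    show "compact (S (None, True))"
      by (simp add: S_def compact_B compact_Times)
    show "compact (S (Some k, True))" if "k \<in> I" for k
      using compact_L[OF that] by (simp add: S_def compact_Times)
    show "compact (S (Some k, False))" if "k \<in> I" for k
      by (simp add: S_def compact_Times)
  qed
  moreover have "continuous_on (S j) (q j)" if "j \<in> J" for j
    using that
  proof (rule J_cases[where P = "\<lambda>j. continuous_on (S j) (q j)"])
    have "continuous_on (S (None, True)) (\<lambda>s. (fst s, i (fst (snd s))))"
      by (intro continuous_intros continuous_on_compose2[OF cont_i]) (auto simp: S_def)
    then show "continuous_on (S (None, True)) (q (None, True))"
      by (simp add: q_def case_prod_unfold)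
    show "continuous_on (S (Some k, True)) (q (Some k, True))" if "k \<in> I" for k
    proof -
      have "continuous_on (S (Some k, True)) (\<lambda>s. case snd s of (x, t) \<Rightarrow> c k x t)"
        by (intro continuous_intros continuous_on_compose2[OF cont_c[OF that]]) (auto simp: S_def)
      then have "continuous_on (S (Some k, True)) (\<lambda>s. (fst s, case snd s of (x, t) \<Rightarrow> c k x t))"
        by (intro continuous_intros)
      then show ?thesis by (simp add: q_def case_prod_unfold)
    qed
    have "continuous_on (S (Some k, False)) (\<lambda>s. (fst s, a k))" for k
      by (intro continuous_intros)
    then show "continuous_on (S (Some k, False)) (q (Some k, False))" if "k \<in> I" for k
      by (simp add: q_def case_prod_unfold)
  qed
  moreover have "continuous_on (S j) (G j)" if "j \<in> J" for j
    using that
  proof (rule J_cases[where P = "\<lambda>j. continuous_on (S j) (G j)"])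
    have "continuous_on (S (None, True)) (\<lambda>s. case (fst s, fst (snd s)) of (u, b) \<Rightarrow> \<alpha> u b)"
      by (intro continuous_intros continuous_on_compose2[OF \<alpha>]) (auto simp: S_def)
    then show "continuous_on (S (None, True)) (G (None, True))"
      by (simp add: G_def case_prod_unfold)
    show "continuous_on (S (Some k, True)) (G (Some k, True))" if "k \<in> I" for k
      unfolding S_def G_def using \<beta>[OF that] by (simp add: case_prod_unfold)
    show "continuous_on (S (Some k, False)) (G (Some k, False))" if "k \<in> I" for k
    proof -
      have "continuous_on (S (Some k, False)) (\<lambda>s. \<gamma> k (fst s))"
        by (intro continuous_intros continuous_on_compose2[OF \<gamma>[OF that]]) (auto simp: S_def)
      then show ?thesis by (simp add: G_def case_prod_unfold)
    qed
  qed
  moreover have "G j s = G j' s'"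
    if "j \<in> J" "j' \<in> J" "s \<in> S j" "s' \<in> S j'" "q j s = q j' s'" for j j' s s'
  proof -
    \<comment> \<open>Different parameters can describe the same point only at heights 0 and 1, so
      agreement reduces to three facts: for a cone point on the base, for a cone point at an apex,
      and for two cone points.\<close>
    have base: "\<beta> k u x t = \<alpha> u b"
      if "k \<in> I" "u \<in> {0..1}" "x \<in> L k" "t \<in> {0..1}" "b \<in> B" "c k x t = i b" for k u x t b
    proof -
      have "t = 0" using c_base that by blast
      moreover have "f k x = b" using that \<open>t = 0\<close> c_0 f_in inj_i by (metis inj_onD)
      ultimately show ?thesis using \<beta>0 that by simp
    qed
    have apex: "\<beta> k u x t = \<gamma> k' u"
      if "k \<in> I" "u \<in> {0..1}" "x \<in> L k" "t \<in> {0..1}" "k' \<in> I" "c k x t = a k'" for k u x t k'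
      using c_apex[of k x t k'] \<beta>1 that by blast
    have cone: "\<beta> k u x t = \<beta> k' u x' t'"
      if k: "k \<in> I" "u \<in> {0..1}" "x \<in> L k" "t \<in> {0..1}" "k' \<in> I" "x' \<in> L k'" "t' \<in> {0..1}"
        and eq: "c k x t = c k' x' t'" for k u x t k' x' t'
    proof -
      \<comment> \<open>If either height is an end of the interval, one of the two points lies on
        the base or is an apex and the previous facts apply; otherwise \<open>inj_c\<close> says
        that the parameters coincide.\<close>
      consider "t = 0" | "t' = 0" | "t = 1" | "t' = 1" | "t \<in> {0<..<1}" "t' \<in> {0<..<1}"
        using k by fastforce
      then show ?thesis
      proof cases
        case 1
        then have "c k' x' t' = i (f k x)" using eq c_0 k by metis
        then show ?thesis using base[of k' u x' t' "f k x"] k \<beta>0 1 f_in by simp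
      next
        case 2
        then have "c k x t = i (f k' x')" using eq c_0 k by metis
        then show ?thesis using base[of k u x t "f k' x'"] k \<beta>0 2 f_in by simp
      next
        case 3
        then have "c k' x' t' = a k" using eq c_1 k by metis
        then show ?thesis using apex[of k' u x' t' k] k \<beta>1 3 by simp
      next
        case 4
        then have "c k x t = a k'" using eq c_1 k by metis
        then show ?thesis using apex[of k u x t k'] k \<beta>1 4 by simp
      next
        case 5
        then show ?thesis using inj_c k eq by metis
      qed
    qed
    obtain m p m' p' u x t u' x' t' where
      eqs: "j = (m, p)" "j' = (m', p')" "s = (u, x, t)" "s' = (u', x', t')"
      by (metis prod.exhaust)
    note jj = that
    have "u = u'" using that(5) by (simp add: eqs q_def)
    have u: "u \<in> {0..1}" using that(3) by (simp add: eqs S_def)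
    have q: "q (m, p) (u, x, t) = q (m', p') (u, x', t')" using that(5) \<open>u = u'\<close> by (simp add: eqs)
    consider "m = None" "x \<in> B" | k where "m = Some k" "k \<in> I" "p" "x \<in> L k" "t \<in> {0..1}"
      | k where "m = Some k" "k \<in> I" "\<not> p"
      using jj(1,3) by (cases m; cases p) (auto simp: eqs J_def S_def)
    note C = this
    consider "m' = None" "x' \<in> B" | k where "m' = Some k" "k \<in> I" "p'" "x' \<in> L k" "t' \<in> {0..1}"
      | k where "m' = Some k" "k \<in> I" "\<not> p'"
      using jj(2,4) by (cases m'; cases p') (auto simp: eqs J_def S_def)
    note C' = this
    have "G (m, p) (u, x, t) = G (m', p') (u, x', t')"
    proof (rule C)
      assume 1: "m = None" "x \<in> B"
      show ?thesis
      proof (rule C')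
        assume "m' = None" "x' \<in> B"
        then show ?thesis using 1 q inj_i by (simp add: q_def G_def inj_on_eq_iff)
      next
        fix k assume 2: "m' = Some k" "k \<in> I" "p'" "x' \<in> L k" "t' \<in> {0..1}"
        then have "c k x' t' = i x" using 1 q by (simp add: q_def)
        then show ?thesis using 1 2 base[OF 2(2) u 2(4,5) 1(2)] by (simp add: G_def)
      next
        fix k assume 2: "m' = Some k" "k \<in> I" "\<not> p'"
        then have "a k = i x" using 1 q by (simp add: q_def)
        then show ?thesis using a_base[OF 2(2) 1(2)] by simp
      qed
    next
      fix k assume 1: "m = Some k" "k \<in> I" "p" "x \<in> L k" "t \<in> {0..1}"
      show ?thesis
      proof (rule C')
        assume 2: "m' = None" "x' \<in> B"
        then have "c k x t = i x'" using 1 q by (simp add: q_def)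
        then show ?thesis using 1 2 base[OF 1(2) u 1(4,5) 2(2)] by (simp add: G_def)
      next
        fix k' assume 2: "m' = Some k'" "k' \<in> I" "p'" "x' \<in> L k'" "t' \<in> {0..1}"
        then have "c k x t = c k' x' t'" using 1 q by (simp add: q_def)
        then show ?thesis using 1 2 cone[OF 1(2) u 1(4,5) 2(2,4,5)] by (simp add: G_def)
      next
        fix k' assume 2: "m' = Some k'" "k' \<in> I" "\<not> p'"
        then have "c k x t = a k'" using 1 q by (simp add: q_def)
        then show ?thesis using 1 2 apex[OF 1(2) u 1(4,5) 2(2)] by (simp add: G_def)
      qed
    next
      fix k assume 1: "m = Some k" "k \<in> I" "\<not> p"
      show ?thesis
      proof (rule C')
        assume 2: "m' = None" "x' \<in> B"
        then have "a k = i x'" using 1 q by (simp add: q_def)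
        then show ?thesis using a_base[OF 1(2) 2(2)] by simp
      next
        fix k' assume 2: "m' = Some k'" "k' \<in> I" "p'" "x' \<in> L k'" "t' \<in> {0..1}"
        then have "c k' x' t' = a k" using 1 q by (simp add: q_def)
        then show ?thesis using 1 2 apex[OF 2(2) u 2(4,5) 1(2)] by (simp add: G_def)
      next
        fix k' assume 2: "m' = Some k'" "k' \<in> I" "\<not> p'"
        then have "k = k'" using 1 q inj_a by (simp add: q_def inj_on_eq_iff)
        then show ?thesis using 1 2 by (simp add: G_def)
      qed
    qed
    then show ?thesis using \<open>u = u'\<close> by (simp add: eqs)
  qed
  ultimately have "\<exists>F. continuous_on (\<Union>j\<in>J. q j ` S j) F \<and> (\<forall>j\<in>J. \<forall>s\<in>S j. F (q j s) = G j s)"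
    by (rule glue_compact_pieces[OF Hausdorff_euclidean_Times[OF T2]])
  then obtain F where F: "continuous_on (\<Union>j\<in>J. q j ` S j) F"
    "\<And>j s. \<lbrakk>j \<in> J; s \<in> S j\<rbrakk> \<Longrightarrow> F (q j s) = G j s"
    by blast
  have Fb: "F (u, i b) = \<alpha> u b" if "u \<in> {0..1}" "b \<in> B" for u b
    using F(2)[of "(None, True)" "(u, b, 0)"] that by (simp add: J_def S_def q_def G_def)
  have Fc: "F (u, c k x t) = \<beta> k u x t" if "k \<in> I" "u \<in> {0..1}" "x \<in> L k" "t \<in> {0..1}" for k u x t
    using F(2)[of "(Some k, True)" "(u, x, t)"] that by (simp add: J_def S_def q_def G_def)
  have Fa: "F (u, a k) = \<gamma> k u" if "k \<in> I" "u \<in> {0..1}" for k u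
    using F(2)[of "(Some k, False)" "(u, undefined, 1)"] that by (simp add: J_def S_def q_def G_def)
  have "{0..1} \<times> X \<subseteq> (\<Union>j\<in>J. q j ` S j)"
  proof clarify
    fix u :: real and y assume u: "u \<in> {0..1}" and "y \<in> X"
    from this(2) show "(u, y) \<in> (\<Union>j\<in>J. q j ` S j)"
    proof (cases rule: X_cases)
      case (base b)
      then have "(u, y) = q (None, True) (u, b, 0)" "(u, b, 0) \<in> S (None, True)"
        using u by (auto simp: q_def S_def)
      then show ?thesis by (auto simp: J_def)
    next
      case (apex k)
      then have "(u, y) = q (Some k, False) (u, undefined, 1)" "(u, undefined, 1) \<in> S (Some k, False)"
        "(Some k, False) \<in> J"
        using u by (auto simp: q_def S_def J_def)
      then show ?thesis by (metis UN_I image_eqI)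
    next
      case (cone k x t)
      then have "(u, y) = q (Some k, True) (u, x, t)" "(u, x, t) \<in> S (Some k, True)"
        "(Some k, True) \<in> J"
        using u by (auto simp: q_def S_def J_def)
      then show ?thesis by (metis UN_I image_eqI)
    qed
  qed
  then have "continuous_on ({0..1} \<times> X) F"
    using F(1) by (rule continuous_on_subset[rotated])
  moreover have "F (u, y) \<in> Z" if "u \<in> {0..1}" "y \<in> X" for u y
    using that(2) by (cases rule: X_cases) (auto simp: Fa Fb Fc that(1) \<alpha>Z \<beta>Z \<gamma>Z simp del: atLeastAtMost_iff)
  ultimately show ?thesis using Fa Fb Fc by blast
qed

text \<open>The cone over \<open>x\<close> lengthened below by a track in the base: parameter -1 is
  the point \<open>h k x 1\<close>, parameter 0 is the attaching point \<open>h k x 0\<close>, and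
  parameter 1 is the apex. A homotopy of attaching maps thus becomes a piece of the cone.\<close>

definition through :: "('k \<Rightarrow> 'b \<Rightarrow> real \<Rightarrow> 'b) \<Rightarrow> 'k \<Rightarrow> 'b \<Rightarrow> real \<Rightarrow> 'x" where
  "through h k x t = (if t \<le> 0 then i (h k x (- t)) else c k x t)"

lemma through_cont:
  assumes "k \<in> I" "continuous_on (L k \<times> {0..1}) (\<lambda>(x, t). h k x t)"
    and "\<And>x t. x \<in> L k \<Longrightarrow> t \<in> {0..1} \<Longrightarrow> h k x t \<in> B" "\<And>x. x \<in> L k \<Longrightarrow> h k x 0 = f k x"
  shows "continuous_on (L k \<times> {-1..1}) (\<lambda>(x, t). through h k x t)"
proof -
  have "continuous_on (L k \<times> {-1..1})
    (\<lambda>p. if snd p \<le> 0 then i (h k (fst p) (- snd p)) else c k (fst p) (snd p))"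
  proof (rule continuous_on_cases_le)
    have "continuous_on {p \<in> L k \<times> {-1..1}. snd p \<le> 0} (\<lambda>p. case (fst p, - snd p) of (x, t) \<Rightarrow> h k x t)"
      by (rule continuous_on_compose2[OF assms(2)]) (auto intro!: continuous_intros)
    then show "continuous_on {p \<in> L k \<times> {-1..1}. snd p \<le> 0} (\<lambda>p. i (h k (fst p) (- snd p)))"
      using assms(3) by (intro continuous_on_compose2[OF cont_i]) auto
    have "continuous_on {p \<in> L k \<times> {-1..1}. 0 \<le> snd p} (\<lambda>p. case p of (x, t) \<Rightarrow> c k x t)"
      by (rule continuous_on_subset[OF cont_c[OF assms(1)]]) auto
    then show "continuous_on {p \<in> L k \<times> {-1..1}. 0 \<le> snd p} (\<lambda>p. c k (fst p) (snd p))"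
      by (simp add: case_prod_unfold)
    show "i (h k (fst p) (- snd p)) = c k (fst p) (snd p)" if "p \<in> L k \<times> {-1..1}" "snd p = 0" for p
      using that assms(1,4) c_0 by auto
  qed (intro continuous_intros)
  then show ?thesis
    by (simp add: case_prod_unfold through_def)
qed

lemma through_in:
  assumes "k \<in> I" "x \<in> L k" "t \<in> {-1..1}" "\<And>x t. x \<in> L k \<Longrightarrow> t \<in> {0..1} \<Longrightarrow> h k x t \<in> B"
  shows "through h k x t \<in> X"
  using assms by (auto simp: through_def intro!: i_in c_in)

text \<open>The case of a homotopy that does not depend on time, read off at time 0.\<close>

lemma extend_map:
  fixes \<alpha> :: "'b \<Rightarrow> 'z::topological_space"
  assumes \<alpha>: "continuous_on B \<alpha>"
    and \<beta>: "\<And>k. k \<in> I \<Longrightarrow> continuous_on (L k \<times> {0..1}) (\<lambda>(x, t). \<beta> k x t)"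
    and \<beta>0: "\<And>k x. \<lbrakk>k \<in> I; x \<in> L k\<rbrakk> \<Longrightarrow> \<beta> k x 0 = \<alpha> (f k x)"
    and \<beta>1: "\<And>k x. \<lbrakk>k \<in> I; x \<in> L k\<rbrakk> \<Longrightarrow> \<beta> k x 1 = \<gamma> k"
    and Z: "\<And>b. b \<in> B \<Longrightarrow> \<alpha> b \<in> Z"
      "\<And>k x t. \<lbrakk>k \<in> I; x \<in> L k; t \<in> {0..1}\<rbrakk> \<Longrightarrow> \<beta> k x t \<in> Z" "\<And>k. k \<in> I \<Longrightarrow> \<gamma> k \<in> Z"
  shows "\<exists>F. continuous_on X F \<and> (\<forall>y\<in>X. F y \<in> Z) \<and> (\<forall>b\<in>B. F (i b) = \<alpha> b) \<and>
      (\<forall>k\<in>I. F (a k) = \<gamma> k \<and> (\<forall>x\<in>L k. \<forall>t\<in>{0..1}. F (c k x t) = \<beta> k x t))"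
proof -
  have "continuous_on ({0..1::real} \<times> B) (\<lambda>p. \<alpha> (snd p))"
    by (rule continuous_on_compose2[OF \<alpha>]) (auto intro!: continuous_intros)
  then have 1: "continuous_on ({0..1::real} \<times> B) (\<lambda>(u, b). \<alpha> b)" by (simp add: case_prod_unfold)
  have 2: "continuous_on ({0..1::real} \<times> L k \<times> {0..1}) (\<lambda>(u, x, t). \<beta> k x t)" if "k \<in> I" for k
    using continuous_on_compose2[OF \<beta>[OF that] continuous_on_snd[OF continuous_on_id],
        of "({0..1} :: real set) \<times> L k \<times> {0..1}"] by (auto simp: case_prod_unfold)
  have "\<exists>F. continuous_on ({0..1} \<times> X) F \<and> (\<forall>u\<in>{0..1::real}. (\<forall>y\<in>X. F (u, y) \<in> Z) \<and>
      (\<forall>b\<in>B. F (u, i b) = \<alpha> b) \<and>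
      (\<forall>k\<in>I. F (u, a k) = \<gamma> k \<and> (\<forall>x\<in>L k. \<forall>t\<in>{0..1}. F (u, c k x t) = \<beta> k x t)))"
    by (rule extend_homotopy[where \<alpha> = "\<lambda>_. \<alpha>" and \<beta> = "\<lambda>k _. \<beta> k" and \<gamma> = "\<lambda>k _. \<gamma> k"])
      (rule 1 2 continuous_on_const \<beta>0 \<beta>1 Z; assumption)+
  then obtain F where F: "continuous_on ({0..1::real} \<times> X) F"
    "\<And>u y. \<lbrakk>u \<in> {0..1}; y \<in> X\<rbrakk> \<Longrightarrow> F (u, y) \<in> Z"
    "\<And>u b. \<lbrakk>u \<in> {0..1}; b \<in> B\<rbrakk> \<Longrightarrow> F (u, i b) = \<alpha> b"
    "\<And>k u x t. \<lbrakk>k \<in> I; u \<in> {0..1}; x \<in> L k; t \<in> {0..1}\<rbrakk> \<Longrightarrow> F (u, c k x t) = \<beta> k x t"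
    "\<And>k u. \<lbrakk>k \<in> I; u \<in> {0..1}\<rbrakk> \<Longrightarrow> F (u, a k) = \<gamma> k"
    by blast
  have "continuous_on X (\<lambda>y. F (0, y))"
    by (rule continuous_on_compose2[OF F(1)]) (auto intro!: continuous_intros)
  then show ?thesis
    using F(2-) by (intro exI[of _ "\<lambda>y. F (0, y)"]) simp
qed

text \<open>Going through \<open>h\<close> and back before entering the cone is undone by the straight-line homotopy
  between the reparametrization \<open>max (- 2 * t) (4 * t - 3)\<close> and the identity.\<close>

lemma through_back_homotopic_id:
  assumes h: "\<And>k. k \<in> I \<Longrightarrow> continuous_on (L k \<times> {0..1}) (\<lambda>(x, t). h k x t)"
    and hB: "\<And>k x t. k \<in> I \<Longrightarrow> x \<in> L k \<Longrightarrow> t \<in> {0..1} \<Longrightarrow> h k x t \<in> B"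
    and h0: "\<And>k x. k \<in> I \<Longrightarrow> x \<in> L k \<Longrightarrow> h k x 0 = f k x"
    and \<theta>i: "\<And>b. b \<in> B \<Longrightarrow> \<theta> (i b) = i b"
    and \<theta>c: "\<And>k x t. \<lbrakk>k \<in> I; x \<in> L k; t \<in> {0..1}\<rbrakk> \<Longrightarrow> \<theta> (c k x t) = through h k x (max (- 2 * t) (4 * t - 3))"
    and \<theta>a: "\<And>k. k \<in> I \<Longrightarrow> \<theta> (a k) = a k"
  shows "homotopic_with_canon (\<lambda>_. True) X X \<theta> id"
proof -
  \<comment> \<open>\<open>max (- 2 * t) (4 * t - 3)\<close> goes from 0 down to -1 at
    \<open>t = 1/2\<close> and up to 1 at \<open>t = 1\<close>, the effect of two doublings of the
    height one after the other. Like the identity it sends 0 to 0 and 1 to 1, so the homotopy fixes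
    the base and the apexes.\<close>
  define r :: "real \<Rightarrow> real \<Rightarrow> real" where "r = (\<lambda>u t. (1 - u) * max (- 2 * t) (4 * t - 3) + u * t)"
  have r_in: "r u t \<in> {-1..1}" if "u \<in> {0..1}" "t \<in> {0..1}" for u t
  proof -
    have "max (- 2 * t) (4 * t - 3) \<in> {-1..1}" "t \<in> {-1..1}" using that by auto
    from convexD[OF convex_closed_interval[of "-1::real" 1] this, of "1 - u" u] show ?thesis using that by (simp add: r_def)
  qed
  have base: "continuous_on ({0..1::real} \<times> B) (\<lambda>(u, b). i b)"
    using continuous_on_compose2[OF cont_i continuous_on_snd[OF continuous_on_id], of "({0..1} :: real set) \<times> B"]
    by (auto simp: case_prod_unfold)
  have cone: "continuous_on ({0..1} \<times> L k \<times> {0..1}) (\<lambda>(u, x, t). through h k x (r u t))" if "k \<in> I" for k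
  proof -
    have "continuous_on ({0..1} \<times> L k \<times> {0..1})
        (\<lambda>s. case (fst (snd s), r (fst s) (snd (snd s))) of (x, t) \<Rightarrow> through h k x t)"
      using r_in
      by (intro continuous_on_compose2[OF through_cont[of k h]])
        (auto simp: that h hB h0 r_def intro!: continuous_intros simp del: atLeastAtMost_iff)
    then show ?thesis by (simp add: case_prod_unfold)
  qed
  have bot: "through h k x (r u 0) = i (f k x)" if "k \<in> I" "u \<in> {0..1}" "x \<in> L k" for k u x
    using that h0 by (simp add: r_def through_def)
  have top: "through h k x (r u 1) = a k" if "k \<in> I" "u \<in> {0..1}" "x \<in> L k" for k u x
    using that c_1 by (simp add: r_def through_def)
  have inX: "through h k x (r u t) \<in> X" if "k \<in> I" "u \<in> {0..1}" "x \<in> L k" "t \<in> {0..1}" for k u x t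
    using that r_in by (intro through_in hB)
  have "\<exists>F. continuous_on ({0..1} \<times> X) F \<and> (\<forall>u\<in>{0..1}. (\<forall>y\<in>X. F (u, y) \<in> X) \<and>
      (\<forall>b\<in>B. F (u, i b) = i b) \<and>
      (\<forall>k\<in>I. F (u, a k) = a k \<and> (\<forall>x\<in>L k. \<forall>t\<in>{0..1}. F (u, c k x t) = through h k x (r u t))))"
    by (rule extend_homotopy[where \<alpha> = "\<lambda>_. i" and \<beta> = "\<lambda>k u x t. through h k x (r u t)" and \<gamma> = "\<lambda>k _. a k"])
      (rule base cone continuous_on_const bot top i_in inX a_in; assumption)+
  then obtain F where F: "continuous_on ({0..1} \<times> X) F"
    "\<And>u y. \<lbrakk>u \<in> {0..1}; y \<in> X\<rbrakk> \<Longrightarrow> F (u, y) \<in> X"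
    "\<And>u b. \<lbrakk>u \<in> {0..1}; b \<in> B\<rbrakk> \<Longrightarrow> F (u, i b) = i b"
    "\<And>k u x t. \<lbrakk>k \<in> I; u \<in> {0..1}; x \<in> L k; t \<in> {0..1}\<rbrakk> \<Longrightarrow> F (u, c k x t) = through h k x (r u t)"
    "\<And>k u. \<lbrakk>k \<in> I; u \<in> {0..1}\<rbrakk> \<Longrightarrow> F (u, a k) = a k"
    by blast
  show ?thesis
  proof (rule homotopic_with_canonI[OF F(1)])
    fix y assume y: "y \<in> X"
    show "F (0, y) = \<theta> y"
      using y by (cases rule: X_cases) (simp_all add: F \<theta>i \<theta>c \<theta>a r_def)
    show "F (1, y) = id y"
      using y
    proof (cases rule: X_cases)
      case (cone k x t)
      then have "F (1, y) = through h k x t" using F(4)[of k 1 x t] by (simp add: r_def)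
      also have "\<dots> = c k x t" using cone c_0[of k x] h0[of k x] by (auto simp: through_def)
      finally show ?thesis using cone by simp
    qed (simp_all add: F)
  qed (use F in blast)
qed

end

section \<open>Homotopic attaching maps give homotopy equivalent spaces\<close>

text \<open>The lower half of each cone of \<open>X\<close> is spent on running through
  \<open>h\<close>, the upper half covers the cone of \<open>Y\<close>. Since \<open>through\<close>
  traverses \<open>h\<close> from 1 to 0, the homotopy has to start at the attaching map
  \<open>g\<close> of the target and to end at \<open>f\<close>.\<close>

lemma cone_attachment_map:
  assumes X: "cone_attachment B I L f X i c a" and Y: "cone_attachment B I L g Y i' c' a'"
    and h: "\<And>k. k \<in> I \<Longrightarrow> continuous_on (L k \<times> {0..1::real}) (\<lambda>(x, t). h k x t)"
    and hB: "\<And>k x t. k \<in> I \<Longrightarrow> x \<in> L k \<Longrightarrow> t \<in> {0..1} \<Longrightarrow> h k x t \<in> B"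
    and h0: "\<And>k x. k \<in> I \<Longrightarrow> x \<in> L k \<Longrightarrow> h k x 0 = g k x"
    and h1: "\<And>k x. k \<in> I \<Longrightarrow> x \<in> L k \<Longrightarrow> h k x 1 = f k x"
  shows "\<exists>\<phi>. continuous_on X \<phi> \<and> (\<forall>y\<in>X. \<phi> y \<in> Y) \<and> (\<forall>b\<in>B. \<phi> (i b) = i' b) \<and>
    (\<forall>k\<in>I. \<phi> (a k) = a' k \<and>
      (\<forall>x\<in>L k. \<forall>t\<in>{0..1}. \<phi> (c k x t) = cone_attachment.through i' c' h k x (2 * t - 1)))"
proof -
  interpret X: cone_attachment B I L f X i c a by fact
  interpret Y: cone_attachment B I L g Y i' c' a' by fact
  show ?thesis
  proof (rule X.extend_map)
    show "continuous_on B i'" by (fact Y.cont_i)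
    show "continuous_on (L k \<times> {0..1}) (\<lambda>(x, t). Y.through h k x (2 * t - 1))" if "k \<in> I" for k
    proof -
      have "continuous_on (L k \<times> {0..1}) (\<lambda>s. case (fst s, 2 * snd s - 1) of (x, t) \<Rightarrow> Y.through h k x t)"
        by (rule continuous_on_compose2[OF Y.through_cont[where h = h, OF that h hB h0]])
          (auto simp: that intro!: continuous_intros)
      then show ?thesis by (simp add: case_prod_unfold)
    qed
    show "Y.through h k x (2 * 0 - 1) = i' (f k x)" if "k \<in> I" "x \<in> L k" for k x
      using that by (simp add: Y.through_def h1)
    show "Y.through h k x (2 * 1 - 1) = a' k" if "k \<in> I" "x \<in> L k" for k x
      using that by (simp add: Y.through_def Y.c_1)
    show "Y.through h k x (2 * t - 1) \<in> Y" if "k \<in> I" "x \<in> L k" "t \<in> {0..1}" for k x t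
      using that hB by (intro Y.through_in) auto
  qed (fact Y.i_in Y.a_in)+
qed

lemma cone_attachment_round_trip:
  assumes X: "cone_attachment B I L f X i c a" and Y: "cone_attachment B I L g Y i' c' a'"
    and h: "\<And>k. k \<in> I \<Longrightarrow> continuous_on (L k \<times> {0..1::real}) (\<lambda>(x, t). h k x t)"
    and hB: "\<And>k x t. k \<in> I \<Longrightarrow> x \<in> L k \<Longrightarrow> t \<in> {0..1} \<Longrightarrow> h k x t \<in> B"
    and h0: "\<And>k x. k \<in> I \<Longrightarrow> x \<in> L k \<Longrightarrow> h k x 0 = f k x"
    and h': "\<And>k x t. k \<in> I \<Longrightarrow> x \<in> L k \<Longrightarrow> t \<in> {0..1} \<Longrightarrow> h' k x t = h k x (1 - t)"
    and \<phi>: "\<forall>b\<in>B. \<phi> (i b) = i' b"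
      "\<forall>k\<in>I. \<phi> (a k) = a' k \<and>
        (\<forall>x\<in>L k. \<forall>t\<in>{0..1}. \<phi> (c k x t) = cone_attachment.through i' c' h' k x (2 * t - 1))"
    and \<psi>: "\<forall>b\<in>B. \<psi> (i' b) = i b"
      "\<forall>k\<in>I. \<psi> (a' k) = a k \<and>
        (\<forall>x\<in>L k. \<forall>t\<in>{0..1}. \<psi> (c' k x t) = cone_attachment.through i c h k x (2 * t - 1))"
  shows "homotopic_with_canon (\<lambda>_. True) X X (\<psi> \<circ> \<phi>) id"
proof -
  interpret X: cone_attachment B I L f X i c a by fact
  interpret Y: cone_attachment B I L g Y i' c' a' by fact
  show ?thesis
  proof (rule X.through_back_homotopic_id[OF h hB h0])
    fix k x t assume k: "k \<in> I" "x \<in> L k" "t \<in> {0..1::real}"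
    show "(\<psi> \<circ> \<phi>) (c k x t) = X.through h k x (max (- 2 * t) (4 * t - 3))"
    \<comment> \<open>Up to height 1/2 the point is sent into the base, where \<psi> keeps it,
      namely at \<open>h k x (2 * t)\<close> because \<open>h'\<close> is \<open>h\<close> reversed.
      Above 1/2 the cone is entered and its height is doubled a second time, which gives
      \<open>2 * (2 * t - 1) - 1\<close>.\<close>
    proof (cases "t \<le> 1/2")
      case True
      then have "\<phi> (c k x t) = i' (h k x (2 * t))"
        using \<phi>(2) k h'[of k x "1 - 2 * t"] by (simp add: Y.through_def)
      moreover have "h k x (2 * t) \<in> B" using hB k True by simp
      moreover have "max (- 2 * t) (4 * t - 3) = - 2 * t" using True by simp
      ultimately show ?thesis
        using \<psi>(1) k by (simp add: X.through_def)
    next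
      case False
      then have "\<phi> (c k x t) = c' k x (2 * t - 1)"
        using \<phi>(2) k by (simp add: Y.through_def)
      moreover have "\<psi> (c' k x (2 * t - 1)) = X.through h k x (2 * (2 * t - 1) - 1)"
        using \<psi>(2) k False by simp
      ultimately show ?thesis
        using False by (simp add: max_def algebra_simps)
    qed
  qed (use \<phi> \<psi> in auto)
qed

text \<open>The two maps use \<open>h\<close> and its reversal, so either composite walks along the
  homotopy and straight back, and the round trip lemma applies to both with the roles
  exchanged.\<close>

theorem cone_attachment_homotopy_equivalent:
  assumes X: "cone_attachment B I L f X i c a" and Y: "cone_attachment B I L g Y i' c' a'"
    and h: "\<And>k. k \<in> I \<Longrightarrow> continuous_on (L k \<times> {0..1::real}) (\<lambda>(x, t). h k x t)"
    and hB: "\<And>k x t. k \<in> I \<Longrightarrow> x \<in> L k \<Longrightarrow> t \<in> {0..1} \<Longrightarrow> h k x t \<in> B"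
    and h0: "\<And>k x. k \<in> I \<Longrightarrow> x \<in> L k \<Longrightarrow> h k x 0 = f k x"
    and h1: "\<And>k x. k \<in> I \<Longrightarrow> x \<in> L k \<Longrightarrow> h k x 1 = g k x"
  shows "top_of_set X homotopy_equivalent_space top_of_set Y"
proof -
  define h' where "h' = (\<lambda>k x t. h k x (1 - t))"
  have h': "continuous_on (L k \<times> {0..1}) (\<lambda>(x, t). h' k x t)" if "k \<in> I" for k
  proof -
    have "continuous_on (L k \<times> {0..1}) (\<lambda>s. case (fst s, 1 - snd s) of (x, t) \<Rightarrow> h k x t)"
      by (rule continuous_on_compose2[OF h[OF that]]) (auto intro!: continuous_intros)
    then show ?thesis by (simp add: h'_def case_prod_unfold)
  qed
  have h'B: "h' k x t \<in> B" if "k \<in> I" "x \<in> L k" "t \<in> {0..1}" for k x t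
    using that hB by (simp add: h'_def)
  have h'01: "h' k x 0 = g k x" "h' k x 1 = f k x" if "k \<in> I" "x \<in> L k" for k x
    using that h0 h1 by (simp_all add: h'_def)
  obtain \<phi> where \<phi>: "continuous_on X \<phi>" "\<forall>y\<in>X. \<phi> y \<in> Y" "\<forall>b\<in>B. \<phi> (i b) = i' b"
    "\<forall>k\<in>I. \<phi> (a k) = a' k \<and>
      (\<forall>x\<in>L k. \<forall>t\<in>{0..1}. \<phi> (c k x t) = cone_attachment.through i' c' h' k x (2 * t - 1))"
    using cone_attachment_map[where h = h', OF X Y h' h'B h'01] by blast
  obtain \<psi> where \<psi>: "continuous_on Y \<psi>" "\<forall>y\<in>Y. \<psi> y \<in> X" "\<forall>b\<in>B. \<psi> (i' b) = i b"
    "\<forall>k\<in>I. \<psi> (a' k) = a k \<and>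
      (\<forall>x\<in>L k. \<forall>t\<in>{0..1}. \<psi> (c' k x t) = cone_attachment.through i c h k x (2 * t - 1))"
    using cone_attachment_map[where h = h, OF Y X h hB h0 h1] by blast
  have "homotopic_with_canon (\<lambda>_. True) X X (\<psi> \<circ> \<phi>) id"
    by (rule cone_attachment_round_trip[where h = h and h' = h', OF X Y h hB h0 _ \<phi>(3,4) \<psi>(3,4)])
      (simp_all add: h'_def)
  moreover have "homotopic_with_canon (\<lambda>_. True) Y Y (\<phi> \<circ> \<psi>) id"
    by (rule cone_attachment_round_trip[where h = h' and h' = h, OF Y X h' h'B h'01(1) _ \<psi>(3,4) \<phi>(3,4)])
      (simp_all add: h'_def)
  moreover have "continuous_map (top_of_set X) (top_of_set Y) \<phi>" "continuous_map (top_of_set Y) (top_of_set X) \<psi>"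
    using \<phi>(1,2) \<psi>(1,2) by (auto simp: Pi_iff)
  ultimately show ?thesis
    unfolding homotopy_equivalent_space_def by blast
qed

section \<open>Contractible base and contractible cone bottoms give a contractible space\<close>

context cone_attachment
begin

text \<open>An empty \<open>L k\<close> would leave an isolated apex, hence the nonemptiness
  condition. The contractions of \<open>B\<close> and of the \<open>L k\<close> need not be
  compatible with the attaching maps, so they are not run at the same time: the base goes first,
  after which the lower ends of the cones are all at one point and \<open>L k\<close> can be moved
  freely.\<close>

theorem contractible_cone_attachment:
  assumes B: "contractible B" "b0 \<in> B"
    and L: "\<And>k. k \<in> I \<Longrightarrow> contractible (L k)" "\<And>k. k \<in> I \<Longrightarrow> L k \<noteq> {}"
  shows "contractible X"
proof -
  obtain H where H: "continuous_on ({0..1::real} \<times> B) H" "H \<in> {0..1} \<times> B \<rightarrow> B"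
    "\<And>b. H (0, b) = b" "\<And>b. H (1, b) = b0"
    using contractible_homotopy[OF B] by blast
  define l where "l k = (SOME x. x \<in> L k)" for k
  have l: "l k \<in> L k" if "k \<in> I" for k
    using L(2)[OF that] by (simp add: l_def some_in_eq)
  have "\<exists>R. continuous_on ({0..1::real} \<times> L k) R \<and> R \<in> {0..1} \<times> L k \<rightarrow> L k \<and>
      (\<forall>x. R (0, x) = x) \<and> (\<forall>x. R (1, x) = l k)" if "k \<in> I" for k
    by (rule contractible_homotopy[OF L(1)[OF that] l[OF that]])
  then obtain R where R: "\<And>k. k \<in> I \<Longrightarrow> continuous_on ({0..1::real} \<times> L k) (R k)"
    "\<And>k. k \<in> I \<Longrightarrow> R k \<in> {0..1} \<times> L k \<rightarrow> L k"
    "\<And>k x. k \<in> I \<Longrightarrow> R k (0, x) = x" "\<And>k x. k \<in> I \<Longrightarrow> R k (1, x) = l k"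
    by metis
  have R_in: "R k (u, x) \<in> L k" if "k \<in> I" "u \<in> {0..1}" "x \<in> L k" for k u x
    using R(2)[OF that(1)] that by blast
  \<comment> \<open>The track of the attaching point under the contraction of the base. With it
    \<open>through h\<close> runs from \<open>i b0\<close> to the apex for every \<open>x\<close>,
    so its lower end does not depend on \<open>x\<close>.\<close>
  define h where "h k x s = H (s, f k x)" for k x s
  have hB: "h k x t \<in> B" if "k \<in> I" "x \<in> L k" "t \<in> {0..1}" for k x t
    using that H(2) f_in by (auto simp: h_def)
  have h0: "h k x 0 = f k x" for k x
    using H(3) by (simp add: h_def)
  have h: "continuous_on (L k \<times> {0..1}) (\<lambda>(x, t). h k x t)" if "k \<in> I" for k
  proof -
    have "continuous_on (L k \<times> {0..1::real}) (\<lambda>s. f k (fst s))"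
      by (rule continuous_on_compose2[OF cont_f[OF that]]) (auto intro!: continuous_intros)
    then have "continuous_on (L k \<times> {0..1}) (\<lambda>s. H (snd s, f k (fst s)))"
      using f_in[OF that] by (intro continuous_on_compose2[OF H(1)] continuous_intros) auto
    then show ?thesis by (simp add: h_def case_prod_unfold)
  qed
  define T where "T = through h"
  have contT: "continuous_on S (\<lambda>s. T k (p s) (r s))"
    if "k \<in> I" "continuous_on S p" "continuous_on S r" "\<And>s. s \<in> S \<Longrightarrow> p s \<in> L k" "\<And>s. s \<in> S \<Longrightarrow> r s \<in> {-1..1}"
    for k p r and S :: "(real \<times> 'b \<times> real) set"
  proof -
    have "continuous_on S (\<lambda>s. case (p s, r s) of (x, t) \<Rightarrow> through h k x t)"
      using that h hB h0 by (intro continuous_on_compose2[OF through_cont[of k h]] continuous_intros) auto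
    then show ?thesis by (simp add: T_def)
  qed
  have contT': "continuous_on S (\<lambda>s. T k (l k) (r s))"
    if "k \<in> I" "continuous_on S r" "\<And>s. s \<in> S \<Longrightarrow> r s \<in> {-1..1}"
    for k r and S :: "real set"
  proof -
    have "continuous_on S (\<lambda>s. case (l k, r s) of (x, t) \<Rightarrow> through h k x t)"
      using that h hB h0 l by (intro continuous_on_compose2[OF through_cont[of k h]] continuous_intros) auto
    then show ?thesis by (simp add: T_def)
  qed
  have T_in: "T k x t \<in> X" if "k \<in> I" "x \<in> L k" "t \<in> {-1..1}" for k x t
    unfolding T_def using that hB by (intro through_in)
  have T_top: "T k x 1 = a k" if "k \<in> I" "x \<in> L k" for k x
    using that by (simp add: T_def through_def c_1)
  have T_bot: "T k x (- 1) = i b0" for k x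
    by (simp add: T_def through_def h_def H)
  have T_id: "T k x t = c k x t" if "k \<in> I" "x \<in> L k" "t \<in> {0..1}" for k x t
    using that by (auto simp: T_def through_def h_def H c_0)
  have const: "continuous_on ({0..1::real} \<times> B) (\<lambda>(u, b). i b0)"
    by (simp add: case_prod_unfold)
  \<comment> \<open>The cone parameters of the three stages below: \<open>t * (1 + u) - u\<close>
    stretches the height interval down to \<open>-u\<close>, \<open>2 * t - 1\<close> is the result
    of that, and \<open>(2 * t - 1) * (1 - u) - u\<close> pulls everything down to -1.\<close>
  have affine: "t * (1 + u) - u \<in> {-1..1}" "(2 * t - 1) * (1 - u) - u \<in> {-1..1}" "2 * t - 1 \<in> {-1..1}"
    if "u \<in> {0..1}" "t \<in> {0..1}" for u t :: real
  proof -
    have "0 \<le> t * (1 + u)" "t * (1 + u) \<le> 1 * (1 + u)" "0 \<le> t * (1 - u)" "t * (1 - u) \<le> 1 * (1 - u)"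
      using that by (auto intro: mult_left_le_one_le)
    then show "t * (1 + u) - u \<in> {-1..1}" "(2 * t - 1) * (1 - u) - u \<in> {-1..1}" "2 * t - 1 \<in> {-1..1}"
      using that by (auto simp: algebra_simps)
  qed
  \<comment> \<open>Contract the base, dragging the cones behind it, then each \<open>L k\<close>; the whiskers that remain
    retract to \<open>i b0\<close>.\<close>
  have "\<exists>F. continuous_on ({0..1} \<times> X) F \<and> (\<forall>u\<in>{0..1}. (\<forall>y\<in>X. F (u, y) \<in> X) \<and>
      (\<forall>b\<in>B. F (u, i b) = i (H (u, b))) \<and>
      (\<forall>k\<in>I. F (u, a k) = a k \<and> (\<forall>x\<in>L k. \<forall>t\<in>{0..1}. F (u, c k x t) = T k x (t * (1 + u) - u))))"
  proof (rule extend_homotopy)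
    have "continuous_on ({0..1} \<times> B) (\<lambda>s. i (H s))"
      using H(2) by (intro continuous_on_compose2[OF cont_i H(1)]) auto
    then show "continuous_on ({0..1} \<times> B) (\<lambda>(u, b). i (H (u, b)))"
      by (simp add: case_prod_unfold)
    show "continuous_on ({0..1} \<times> L k \<times> {0..1}) (\<lambda>(u, x, t). T k x (t * (1 + u) - u))" if "k \<in> I" for k
      unfolding case_prod_unfold using that affine
      by (intro contT continuous_intros) auto
    show "T k x (0 * (1 + u) - u) = i (H (u, f k x))" if "k \<in> I" "u \<in> {0..1}" "x \<in> L k" for k u x
      using that by (simp add: T_def through_def h_def)
    show "T k x (1 * (1 + u) - u) = a k" if "k \<in> I" "u \<in> {0..1}" "x \<in> L k" for k u x
      using that T_top by simp
    show "i (H (u, b)) \<in> X" if "u \<in> {0..1}" "b \<in> B" for u b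
      using that H(2) by (intro i_in) auto
    show "T k x (t * (1 + u) - u) \<in> X" if "k \<in> I" "u \<in> {0..1}" "x \<in> L k" "t \<in> {0..1}" for k u x t
      using that affine by (intro T_in)
  qed (assumption | rule continuous_on_const a_in)+
  then obtain F where F: "continuous_on ({0..1} \<times> X) F" "\<And>u y. \<lbrakk>u \<in> {0..1}; y \<in> X\<rbrakk> \<Longrightarrow> F (u, y) \<in> X"
    "\<And>u b. \<lbrakk>u \<in> {0..1}; b \<in> B\<rbrakk> \<Longrightarrow> F (u, i b) = i (H (u, b))"
    "\<And>u k. \<lbrakk>u \<in> {0..1}; k \<in> I\<rbrakk> \<Longrightarrow> F (u, a k) = a k"
    "\<And>u k x t. \<lbrakk>u \<in> {0..1}; k \<in> I; x \<in> L k; t \<in> {0..1}\<rbrakk> \<Longrightarrow> F (u, c k x t) = T k x (t * (1 + u) - u)"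
    by blast
  \<comment> \<open>Moving \<open>x\<close> inside \<open>L k\<close> is now compatible with the
    base, because every lower end lies at \<open>i b0\<close>.\<close>
  have "\<exists>F. continuous_on ({0..1} \<times> X) F \<and> (\<forall>u\<in>{0..1}. (\<forall>y\<in>X. F (u, y) \<in> X) \<and>
      (\<forall>b\<in>B. F (u, i b) = i b0) \<and>
      (\<forall>k\<in>I. F (u, a k) = a k \<and> (\<forall>x\<in>L k. \<forall>t\<in>{0..1}. F (u, c k x t) = T k (R k (u, x)) (2 * t - 1))))"
  proof (rule extend_homotopy)
    show "continuous_on ({0..1} \<times> L k \<times> {0..1}) (\<lambda>(u, x, t). T k (R k (u, x)) (2 * t - 1))" if "k \<in> I" for k
      unfolding case_prod_unfold using that R_in affine
      by (intro contT continuous_intros continuous_on_compose2[OF R(1)]) auto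
    show "T k (R k (u, x)) (2 * 0 - 1) = i b0" if "k \<in> I" "u \<in> {0..1}" "x \<in> L k" for k u x
      using T_bot by simp
    show "T k (R k (u, x)) (2 * 1 - 1) = a k" if "k \<in> I" "u \<in> {0..1}" "x \<in> L k" for k u x
      using that T_top R_in by simp
    show "T k (R k (u, x)) (2 * t - 1) \<in> X" if "k \<in> I" "u \<in> {0..1}" "x \<in> L k" "t \<in> {0..1}" for k u x t
      using that R_in affine by (intro T_in) auto
  qed (assumption | rule const continuous_on_const a_in i_in[OF B(2)])+
  then obtain F' where F': "continuous_on ({0..1} \<times> X) F'" "\<And>u y. \<lbrakk>u \<in> {0..1}; y \<in> X\<rbrakk> \<Longrightarrow> F' (u, y) \<in> X"
    "\<And>u b. \<lbrakk>u \<in> {0..1}; b \<in> B\<rbrakk> \<Longrightarrow> F' (u, i b) = i b0"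
    "\<And>u k. \<lbrakk>u \<in> {0..1}; k \<in> I\<rbrakk> \<Longrightarrow> F' (u, a k) = a k"
    "\<And>u k x t. \<lbrakk>u \<in> {0..1}; k \<in> I; x \<in> L k; t \<in> {0..1}\<rbrakk> \<Longrightarrow> F' (u, c k x t) = T k (R k (u, x)) (2 * t - 1)"
    by blast
  \<comment> \<open>By now each cone is mapped to the single path from \<open>i b0\<close> to its
    apex that runs over \<open>l k\<close>. Only this stage moves the apexes: they slide down with
    parameter \<open>1 - 2 * u\<close>.\<close>
  have "\<exists>F. continuous_on ({0..1} \<times> X) F \<and> (\<forall>u\<in>{0..1}. (\<forall>y\<in>X. F (u, y) \<in> X) \<and>
      (\<forall>b\<in>B. F (u, i b) = i b0) \<and>
      (\<forall>k\<in>I. F (u, a k) = T k (l k) ((2 * 1 - 1) * (1 - u) - u) \<and>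
        (\<forall>x\<in>L k. \<forall>t\<in>{0..1}. F (u, c k x t) = T k (l k) ((2 * t - 1) * (1 - u) - u))))"
  proof (rule extend_homotopy)
    show "continuous_on ({0..1} \<times> L k \<times> {0..1}) (\<lambda>(u, x, t). T k (l k) ((2 * t - 1) * (1 - u) - u))"
      if "k \<in> I" for k
      unfolding case_prod_unfold using that l affine
      by (intro contT continuous_intros) auto
    show "continuous_on {0..1} (\<lambda>u. T k (l k) ((2 * 1 - 1) * (1 - u) - u))" if "k \<in> I" for k
      using that by (intro contT' continuous_intros) auto
    show "T k (l k) ((2 * 0 - 1) * (1 - u) - u) = i b0" for k u
      using T_bot by simp
    show "T k (l k) ((2 * t - 1) * (1 - u) - u) \<in> X" if "k \<in> I" "u \<in> {0..1}" "t \<in> {0..1}" for k u and t :: real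
      using that l affine by (intro T_in) auto
    show "T k (l k) ((2 * 1 - 1) * (1 - u) - u) \<in> X" if "k \<in> I" "u \<in> {0..1}" for k u
      using that l by (intro T_in) auto
  qed (assumption | rule const refl i_in[OF B(2)])+
  then obtain F'' where F'': "continuous_on ({0..1} \<times> X) F''" "\<And>u y. \<lbrakk>u \<in> {0..1}; y \<in> X\<rbrakk> \<Longrightarrow> F'' (u, y) \<in> X"
    "\<And>u b. \<lbrakk>u \<in> {0..1}; b \<in> B\<rbrakk> \<Longrightarrow> F'' (u, i b) = i b0"
    "\<And>u k. \<lbrakk>u \<in> {0..1}; k \<in> I\<rbrakk> \<Longrightarrow> F'' (u, a k) = T k (l k) ((2 * 1 - 1) * (1 - u) - u)"
    "\<And>u k x t. \<lbrakk>u \<in> {0..1}; k \<in> I; x \<in> L k; t \<in> {0..1}\<rbrakk> \<Longrightarrow>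
      F'' (u, c k x t) = T k (l k) ((2 * t - 1) * (1 - u) - u)"
    by blast
  have "homotopic_with_canon (\<lambda>_. True) X X id (\<lambda>y. F (1, y))"
  proof (rule homotopic_with_canonI[OF F(1,2)])
    show "F (0, y) = id y" if "y \<in> X" for y
      using that by (cases rule: X_cases) (simp_all add: F H T_id)
  qed simp_all
  moreover have "homotopic_with_canon (\<lambda>_. True) X X (\<lambda>y. F (1, y)) (\<lambda>y. F'' (0, y))"
  proof (rule homotopic_with_canonI[OF F'(1,2)])
    show "F' (0, y) = F (1, y)" if "y \<in> X" for y
      using that by (cases rule: X_cases) (simp_all add: F F' H R mult.commute)
    show "F' (1, y) = F'' (0, y)" if "y \<in> X" for y
      using that by (cases rule: X_cases) (simp_all add: F'' F' R T_top l)
  qed simp_all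
  moreover have "homotopic_with_canon (\<lambda>_. True) X X (\<lambda>y. F'' (0, y)) (\<lambda>_. i b0)"
  proof (rule homotopic_with_canonI[OF F''(1,2)])
    show "F'' (1, y) = i b0" if "y \<in> X" for y
      using that by (cases rule: X_cases) (simp_all add: F'' T_bot)
  qed simp_all
  ultimately have "homotopic_with_canon (\<lambda>_. True) X X id (\<lambda>_. i b0)"
    by (blast intro: homotopic_with_trans)
  then show ?thesis
    unfolding contractible_def by blast
qed

end

section \<open>Geometric realizations\<close>

text \<open>The carrier of \<open>realization\<close>, as a plain set so that
  \<open>continuous_on\<close>, \<open>compact\<close> and \<open>contractible\<close> apply. An
  empty sum is 0, so the complex \<open>{{}}\<close> has no points.\<close>

definition bary :: "'v set set \<Rightarrow> ('v \<Rightarrow> real) set" where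
  "bary \<Delta> = {f. (\<forall>v. 0 \<le> f v) \<and> (\<exists>\<sigma>\<in>\<Delta>. finite \<sigma> \<and> (\<forall>v. v \<notin> \<sigma> \<longrightarrow> f v = 0) \<and> sum f \<sigma> = 1)}"

lemma realization_bary: "realization \<Delta> = top_of_set (bary \<Delta>)"
  by (simp add: realization_def bary_def)

lemma bary_Un: "bary (\<Delta> \<union> \<Gamma>) = bary \<Delta> \<union> bary \<Gamma>"
  by (auto simp: bary_def)

lemma bary_mono: "\<Delta> \<subseteq> \<Gamma> \<Longrightarrow> bary \<Delta> \<subseteq> bary \<Gamma>"
  by (auto simp: bary_def)

lemma baryI:
  "\<lbrakk>\<And>v. 0 \<le> f v; \<sigma> \<in> \<Delta>; finite \<sigma>; \<And>v. v \<notin> \<sigma> \<Longrightarrow> f v = 0; sum f \<sigma> = 1\<rbrakk> \<Longrightarrow> f \<in> bary \<Delta>"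
  by (auto simp: bary_def)

lemma bary_pos:
  assumes "f \<in> bary \<Delta>"
  obtains v where "f v > 0"
proof -
  obtain \<sigma> where \<sigma>: "\<And>v. 0 \<le> f v" "sum f \<sigma> = 1" using assms unfolding bary_def by blast
  then have "\<exists>v. f v \<noteq> 0" by (metis sum.neutral zero_neq_one)
  then show ?thesis using \<sigma>(1) that by (metis less_eq_real_def)
qed

lemma vertex_in_bary: "{v} \<in> \<Delta> \<Longrightarrow> (\<lambda>w. of_bool (w = v)) \<in> bary \<Delta>"
  by (rule baryI[where \<sigma> = "{v}"]) auto

text \<open>For a finite simplex the conditions on the coordinates are closed and confine the point
  to the cube, which is compact by Tychonoff even if the vertex type is infinite. A finite complex
  is a finite union of such sets.\<close>

lemma compact_bary:
  assumes "finite \<Delta>"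
  shows "compact (bary \<Delta>)"
proof -
  define S where "S \<sigma> = {f. (\<forall>v. 0 \<le> f v) \<and> (\<forall>v. v \<notin> \<sigma> \<longrightarrow> f v = 0) \<and> sum f \<sigma> = (1::real)}" for \<sigma> :: "'a set"
  have "compact (S \<sigma>)" if "finite \<sigma>" for \<sigma>
  proof -
    have coord: "continuous_on UNIV (\<lambda>f :: 'a \<Rightarrow> real. f v)" for v
      by (rule continuous_on_product_then_coordinatewise[OF continuous_on_id])
    have "closed (\<Inter>v. {f :: 'a \<Rightarrow> real. 0 \<le> f v})"
      by (intro closed_INT ballI closed_Collect_le continuous_on_const coord)
    moreover have "closed (\<Inter>v\<in>-\<sigma>. {f :: 'a \<Rightarrow> real. f v = 0})"
      by (intro closed_INT ballI closed_Collect_eq continuous_on_const coord)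
    moreover have "closed {f :: 'a \<Rightarrow> real. sum f \<sigma> = 1}"
      by (intro closed_Collect_eq continuous_on_const continuous_on_sum coord)
    ultimately have "closed ((\<Inter>v. {f. 0 \<le> f v}) \<inter> (\<Inter>v\<in>-\<sigma>. {f. f v = 0}) \<inter> {f :: 'a \<Rightarrow> real. sum f \<sigma> = 1})"
      by (intro closed_Int)
    also have "(\<Inter>v. {f. 0 \<le> f v}) \<inter> (\<Inter>v\<in>-\<sigma>. {f. f v = 0}) \<inter> {f :: 'a \<Rightarrow> real. sum f \<sigma> = 1} = S \<sigma>"
      by (auto simp: S_def)
    finally have "closed (S \<sigma>)" .
    moreover have "compact (PiE UNIV (\<lambda>_ :: 'a. {0..1 :: real}))"
      using compactin_PiE[of "\<lambda>_ :: 'a. euclideanreal" UNIV "\<lambda>_. {0..1}"]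
      by (simp add: euclidean_product_topology)
    moreover have "S \<sigma> \<subseteq> PiE UNIV (\<lambda>_. {0..1})"
    proof
      fix f assume f: "f \<in> S \<sigma>"
      have "f v \<le> 1" for v
        using f member_le_sum[of v \<sigma> f] that by (cases "v \<in> \<sigma>") (auto simp: S_def)
      then show "f \<in> PiE UNIV (\<lambda>_. {0..1})" using f by (auto simp: S_def)
    qed
    ultimately show ?thesis
      by (metis compact_Int_closed inf.absorb_iff2)
  qed
  then have "compact (\<Union>\<sigma>\<in>{\<sigma>\<in>\<Delta>. finite \<sigma>}. S \<sigma>)"
    using assms by (intro compact_UN) auto
  also have "(\<Union>\<sigma>\<in>{\<sigma>\<in>\<Delta>. finite \<sigma>}. S \<sigma>) = bary \<Delta>"
    by (auto simp: S_def bary_def)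
  finally show ?thesis .
qed

lemma continuous_on_coord_fst:
  "continuous_on (S :: (('v \<Rightarrow> real) \<times> real) set) (\<lambda>s. fst s v)"
  by (rule continuous_on_product_then_coordinatewise) (intro continuous_intros)

text \<open>In a simplex \<open>insert k \<sigma>\<close> the coordinate at \<open>k\<close> is the
  height above the point of \<sigma> obtained by rescaling the others. No simplex of
  \<open>A\<close> contains a vertex of \<open>I\<close>, so this coordinate vanishes on the base
  and on the other cones, and the separation conditions of the locale follow.\<close>

theorem bary_cone_attachment:
  fixes A :: "'v set set" and L :: "'v \<Rightarrow> 'v set set"
  assumes I: "finite I" and A: "finite A"
    and disj: "\<And>\<sigma>. \<sigma> \<in> A \<Longrightarrow> \<sigma> \<inter> I = {}"
    and L: "\<And>k. k \<in> I \<Longrightarrow> L k \<subseteq> A" "\<And>k. k \<in> I \<Longrightarrow> {} \<in> L k"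
  shows "cone_attachment (bary A) I (\<lambda>k. bary (L k)) (\<lambda>k x. x) (bary (A \<union> (\<Union>k\<in>I. insert k ` L k)))
    (\<lambda>x. x) (\<lambda>k x t v. (1 - t) * x v + t * of_bool (v = k)) (\<lambda>k v. of_bool (v = k))"
proof
  let ?c = "\<lambda>k (x :: 'v \<Rightarrow> real) t v. (1 - t) * x v + t * of_bool (v = k)"
  have zero: "x k = 0" if "k \<in> I" "x \<in> bary A" for x k
    using that disj unfolding bary_def by blast
  have LA: "x \<in> bary A" if "k \<in> I" "x \<in> bary (L k)" for k x
    using that L(1) bary_mono by blast
  have cI: "?c k x t k = t" "k' \<noteq> k \<Longrightarrow> ?c k x t k' = 0" if "k \<in> I" "k' \<in> I" "x \<in> bary (L k)" for k k' x t
    using zero[OF that(1) LA[OF that(1,3)]] zero[OF that(2) LA[OF that(1,3)]] by simp_all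
  show "Hausdorff_space (euclidean :: ('v \<Rightarrow> real) topology)" by (rule Hausdorff_euclidean_fun)
  show "finite I" by fact
  show "compact (bary A)" using A by (rule compact_bary)
  show "compact (bary (L k))" if "k \<in> I" for k
    using L(1)[OF that] A by (intro compact_bary) (rule finite_subset)
  show "continuous_on (bary (L k)) (\<lambda>x. x)" for k by simp
  show "x \<in> bary A" if "k \<in> I" "x \<in> bary (L k)" for k x using that by (rule LA)
  show "continuous_on (bary A) (\<lambda>x. x)" by simp
  show "continuous_on (bary (L k) \<times> {0..1}) (\<lambda>(x, t). ?c k x t)" for k
    unfolding case_prod_unfold
    by (intro continuous_on_coordinatewise_then_product continuous_intros continuous_on_coord_fst)
  show "?c k x 0 = x" for k x by simp
  show "?c k x 1 = (\<lambda>v. of_bool (v = k))" for k x by simp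
  show "inj_on (\<lambda>x. x) (bary A)" by simp
  show "(\<lambda>v. of_bool (v = k)) \<noteq> b" if "k \<in> I" "b \<in> bary A" for k b
    using zero[OF that] by auto
  show "t = 0" if "k \<in> I" "x \<in> bary (L k)" "t \<in> {0..1}" "b \<in> bary A" "?c k x t = b" for k x t b
    using trans[OF trans[OF cI(1)[OF that(1,1,2), of t, symmetric] fun_cong[OF that(5), of k]] zero[OF that(1,4)]] .
  show "inj_on (\<lambda>k v :: 'v. of_bool (v = k) :: real) I"
  proof (rule inj_onI)
    fix k k' :: 'v assume "(\<lambda>v. of_bool (v = k) :: real) = (\<lambda>v. of_bool (v = k'))"
    from fun_cong[OF this, of k] show "k = k'" by (simp split: if_splits)
  qed
  show "k = k' \<and> t = 1" if "k \<in> I" "x \<in> bary (L k)" "t \<in> {0..1}" "k' \<in> I" "?c k x t = (\<lambda>v. of_bool (v = k'))" for k x t k'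
  proof -
    have 1: "?c k x t k' = 1" using fun_cong[OF that(5), of k'] by simp
    then have "k' = k" using cI(2)[OF that(1,4,2), of t] by (metis zero_neq_one)
    moreover have "t = 1" using cI(1)[OF that(1,1,2), of t] 1 unfolding \<open>k' = k\<close> by (rule trans[OF sym])
    ultimately show ?thesis by simp
  qed
  show "k = k' \<and> x = x' \<and> t = t'"
    if k: "k \<in> I" "x \<in> bary (L k)" "t \<in> {0<..<1}" "k' \<in> I" "x' \<in> bary (L k')" "t' \<in> {0<..<1}"
      and eq: "?c k x t = ?c k' x' t'" for k x t k' x' t'
  proof -
    have *: "?c k x t k = ?c k' x' t' k" using eq by (rule fun_cong)
    note ck = cI(1)[OF k(1,1,2), of t]
    have "k = k'"
    proof (rule ccontr)
      assume "k \<noteq> k'"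
      then have "t = 0" using trans[OF trans[OF ck[symmetric] *] cI(2)[OF k(4,1,5), of t']] by blast
      then show False using k(3) by simp
    qed
    moreover have "t = t'"
    proof -
      note ck[symmetric]
      also note *
      also have "?c k' x' t' k = t'" unfolding \<open>k = k'\<close> by (rule cI(1)[OF k(4,4,5)])
      finally show ?thesis .
    qed
    moreover have "x v = x' v" for v
      using fun_cong[OF eq, of v] \<open>k = k'\<close> \<open>t = t'\<close> k by simp
    ultimately show ?thesis by auto
  qed
  show "bary (A \<union> (\<Union>k\<in>I. insert k ` L k)) = (\<lambda>x. x) ` bary A \<union>
    (\<Union>k\<in>I. insert (\<lambda>v. of_bool (v = k)) (\<Union>x\<in>bary (L k). ?c k x ` {0..1}))" (is "_ = ?R")
  proof (intro equalityI subsetI)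
    fix g assume "g \<in> bary (A \<union> (\<Union>k\<in>I. insert k ` L k))"
    then obtain \<tau> where \<tau>: "\<And>v. 0 \<le> g v" "\<tau> \<in> A \<union> (\<Union>k\<in>I. insert k ` L k)" "finite \<tau>"
      "\<And>v. v \<notin> \<tau> \<Longrightarrow> g v = 0" "sum g \<tau> = 1"
      unfolding bary_def by blast
    consider "\<tau> \<in> A" | k \<sigma> where "k \<in> I" "\<sigma> \<in> L k" "\<tau> = insert k \<sigma>"
      using \<tau>(2) by blast
    then show "g \<in> ?R"
    proof cases
      case 1
      have "g \<in> bary A" using \<tau>(1) 1 \<tau>(3-5) by (rule baryI)
      then show ?thesis by simp
    next
      case \<sigma>: (2 k \<sigma>)
      note 2 = \<sigma>(1,2) \<tau>[unfolded \<sigma>(3)]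
      have "k \<notin> \<sigma>" using 2(1,2) L(1) disj by blast
      then have sum: "sum g \<sigma> = 1 - g k" using 2(5,7) by simp
      show ?thesis
      \<comment> \<open>At height 1 the rescaling would divide by 0. The point is then the apex
        itself, which belongs to the space even if \<open>bary (L k)\<close> is empty.\<close>
      proof (cases "g k = 1")
        case True
        then have "\<forall>v\<in>\<sigma>. g v = 0" using sum 2(3,5) by (simp add: sum_nonneg_eq_0_iff)
        then have "g v = of_bool (v = k)" for v
          using 2(6)[of v] True by (cases "v = k"; cases "v \<in> \<sigma>") auto
        then have "g = (\<lambda>v. of_bool (v = k))" by blast
        then show ?thesis using 2(1) by blast
      next
        case False
        define x where "x = (\<lambda>v. if v = k then 0 else g v / (1 - g k))"
        have gk: "0 \<le> g k" "g k < 1" using False 2(3) sum sum_nonneg[of \<sigma> g] by (auto simp: less_le)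
        have "sum x \<sigma> = (\<Sum>v\<in>\<sigma>. g v / (1 - g k))"
          using \<open>k \<notin> \<sigma>\<close> by (intro sum.cong) (auto simp: x_def)
        also have "\<dots> = 1" using sum gk by (simp flip: sum_divide_distrib)
        finally have "x \<in> bary (L k)"
          using 2(2,3,5,6) gk by (intro baryI[where \<sigma> = \<sigma>]) (auto simp: x_def)
        moreover have "g = ?c k x (g k)" using gk by (auto simp: x_def)
        moreover have "g k \<in> {0..1}" using gk by simp
        ultimately show ?thesis using 2(1) by blast
      qed
    qed
  next
    fix g assume "g \<in> ?R"
    then consider "g \<in> bary A" | k where "k \<in> I" "g = (\<lambda>v. of_bool (v = k))"
      | k x t where "k \<in> I" "x \<in> bary (L k)" "t \<in> {0..1}" "g = ?c k x t"
      by auto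
    then show "g \<in> bary (A \<union> (\<Union>k\<in>I. insert k ` L k))"
    proof cases
      case 1
      then show ?thesis by (simp add: bary_Un)
    next
      case (2 k)
      then have "{k} \<in> A \<union> (\<Union>k\<in>I. insert k ` L k)" using L(2) by blast
      then show ?thesis unfolding 2 by (rule vertex_in_bary)
    next
      case (3 k x t)
      obtain \<sigma> where \<sigma>: "\<And>v. 0 \<le> x v" "\<sigma> \<in> L k" "finite \<sigma>" "\<And>v. v \<notin> \<sigma> \<Longrightarrow> x v = 0" "sum x \<sigma> = 1"
        using 3(2) unfolding bary_def by blast
      have "k \<notin> \<sigma>" using 3(1) \<sigma>(2) L(1) disj by blast
      have "sum g \<sigma> = (\<Sum>v\<in>\<sigma>. (1 - t) * x v)"
        using \<open>k \<notin> \<sigma>\<close> 3(4) by (intro sum.cong) auto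
      also have "\<dots> = 1 - t" using \<sigma>(5) by (simp flip: sum_distrib_left)
      finally have "sum g (insert k \<sigma>) = 1"
        using \<sigma>(3) \<open>k \<notin> \<sigma>\<close> cI(1)[OF 3(1,1,2)] 3(4) by simp
      then show ?thesis
        using \<sigma> 3 by (intro baryI[where \<sigma> = "insert k \<sigma>"]) auto
    qed
  qed
qed

section \<open>The wedge of the base with the suspensions, seen as a cone attachment\<close>

text \<open>The base vertex of a suspension is the pole \<open>Inr True\<close> and not a vertex of
  \<open>L k\<close>: the pole exists even if \<open>L k\<close> has no vertices, and with it as
  wedge point the suspension is a cone attached along a constant map.\<close>

definition susp_wedge_cx :: "'v set set \<Rightarrow> 'v \<Rightarrow> 'v set \<Rightarrow> ('v \<Rightarrow> 'v set set) \<Rightarrow> ('v option \<times> ('v + bool)) option set set" where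
  "susp_wedge_cx A v0 I L = wedge_cx (insert None (Some ` I))
    (\<lambda>i. case i of None \<Rightarrow> (\<lambda>\<sigma>. Inl ` \<sigma>) ` A | Some k \<Rightarrow> susp_cx (L k))
    (\<lambda>i. case i of None \<Rightarrow> Inl v0 | Some k \<Rightarrow> Inr True)"

definition base_vertex :: "'v \<Rightarrow> 'v \<Rightarrow> ('v option \<times> ('v + bool)) option" where
  "base_vertex v0 v = (if v = v0 then None else Some (None, Inl v))"

definition cone_vertex :: "'v \<Rightarrow> 'v \<Rightarrow> ('v option \<times> ('v + bool)) option" where
  "cone_vertex k v = Some (Some k, Inl v)"

text \<open>The opposite pole \<open>Inr True\<close> needs no name of its own: it has become the
  wedge point \<open>None\<close>.\<close>

definition apex :: "'v \<Rightarrow> ('v option \<times> ('v + bool)) option" where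
  "apex k = Some (Some k, Inr False)"

lemma susp_wedge_cx_eq:
  "susp_wedge_cx A v0 I L = {{}, {None}} \<union> (\<lambda>\<sigma>. base_vertex v0 ` \<sigma>) ` A \<union>
    (\<Union>k\<in>I. \<Union>\<sigma>\<in>L k. {cone_vertex k ` \<sigma>, insert None (cone_vertex k ` \<sigma>), insert (apex k) (cone_vertex k ` \<sigma>)})"
proof -
  have base: "(\<lambda>v. if v = Inl v0 then None else Some (None, v)) ` Inl ` \<sigma> = base_vertex v0 ` \<sigma>" for \<sigma> :: "'a set"
    unfolding image_image by (intro image_cong) (auto simp: base_vertex_def)
  have cone: "(\<lambda>v. if v = Inr True then None else Some (Some k, v)) ` (Inl ` \<sigma>) = cone_vertex k ` \<sigma>"
    for k and \<sigma> :: "'a set"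
    unfolding image_image by (intro image_cong) (auto simp: cone_vertex_def)
  have susp: "susp_cx \<Delta> = (\<Union>\<sigma>\<in>\<Delta>. {Inl ` \<sigma>, insert (Inr True) (Inl ` \<sigma>), insert (Inr False) (Inl ` \<sigma>)})" for \<Delta> :: "'a set set"
    unfolding susp_cx_def by (auto; metis Un_empty_right Un_insert_right)
  have "(\<lambda>\<sigma>. (\<lambda>v. if v = Inr True then None else Some (Some k, v)) ` \<sigma>) ` susp_cx (L k) =
      (\<Union>\<sigma>\<in>L k. {cone_vertex k ` \<sigma>, insert None (cone_vertex k ` \<sigma>), insert (apex k) (cone_vertex k ` \<sigma>)})" for k
    unfolding susp by (simp add: image_UN cone apex_def del: if_image_distrib)
  moreover have "(\<lambda>\<sigma>. (\<lambda>v. if v = Inl v0 then None else Some (None, v)) ` \<sigma>) ` (\<lambda>\<sigma>. Inl ` \<sigma>) ` A =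
      (\<lambda>\<sigma>. base_vertex v0 ` \<sigma>) ` A"
    by (simp only: image_image[of _ "\<lambda>\<sigma>. Inl ` \<sigma>"] base)
  moreover have "(\<Union>i\<in>insert None (Some ` I). G i) = G None \<union> (\<Union>k\<in>I. G (Some k))"
    for G :: "'a option \<Rightarrow> ('a option \<times> ('a + bool)) option set set"
    by auto
  ultimately show ?thesis
    unfolding susp_wedge_cx_def wedge_cx_def by (simp only: option.case Un_assoc)
qed

text \<open>The push-forward of barycentric coordinates along \<open>base_vertex v0\<close>.\<close>

definition base_map :: "'v \<Rightarrow> ('v \<Rightarrow> real) \<Rightarrow> ('v option \<times> ('v + bool)) option \<Rightarrow> real" where
  "base_map v0 x w = (case w of None \<Rightarrow> x v0
     | Some (m, n) \<Rightarrow> (case (m, n) of (None, Inl v) \<Rightarrow> if v = v0 then 0 else x v | _ \<Rightarrow> 0))"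

text \<open>The cone parameter \<open>t\<close> runs from the wedge point (the pole \<open>Inr True\<close>) at 0 through \<open>L k\<close> at 1/2
  to the pole \<open>Inr False\<close> at 1.\<close>

definition susp_map :: "'v \<Rightarrow> ('v \<Rightarrow> real) \<Rightarrow> real \<Rightarrow> ('v option \<times> ('v + bool)) option \<Rightarrow> real" where
  "susp_map k x t w = (case w of None \<Rightarrow> max 0 (1 - 2 * t)
     | Some (m, n) \<Rightarrow> (case (m, n) of
          (Some k', Inl v) \<Rightarrow> if k' = k then min (2 * t) (2 - 2 * t) * x v else 0
        | (Some k', Inr s) \<Rightarrow> if k' = k \<and> \<not> s then max 0 (2 * t - 1) else 0
        | (None, _) \<Rightarrow> 0))"

lemma base_map_simps [simp]:
  "base_map v0 x None = x v0"
  "base_map v0 x (base_vertex v0 v) = x v"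
  "base_map v0 x (cone_vertex k v) = 0"
  "base_map v0 x (apex k) = 0"
  by (simp_all add: base_map_def base_vertex_def cone_vertex_def apex_def)

lemma susp_map_simps [simp]:
  "susp_map k x t None = max 0 (1 - 2 * t)"
  "susp_map k x t (cone_vertex k' v) = (if k' = k then min (2 * t) (2 - 2 * t) * x v else 0)"
  "susp_map k x t (apex k') = (if k' = k then max 0 (2 * t - 1) else 0)"
  by (simp_all add: susp_map_def cone_vertex_def apex_def)

text \<open>The vertex type has junk elements that occur in no simplex:
  \<open>Some (None, Inl r)\<close>, the elements \<open>Some (None, Inr s)\<close> and
  \<open>Some (Some k, Inr True)\<close>. The last case collects them, together with the vanishing
  of the coordinates there.\<close>

lemma vertex_cases:
  obtains (None) "w = None" | (base) v where "w = base_vertex r v" "v \<noteq> r" | (cone) k v where "w = cone_vertex k v"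
    | (apex) k where "w = apex k" | (unused) "\<And>v. w \<noteq> base_vertex r v" "\<And>x. base_map r x w = 0" "\<And>k x t. susp_map k x t w = 0"
      "\<And>k v. w \<noteq> cone_vertex k v" "\<And>k. w \<noteq> apex k" "w \<noteq> None"
proof (cases w)
  case (Some p)
  obtain m n where p: "p = (m, n)" by fastforce
  show ?thesis
  proof (cases "(\<exists>v. m = None \<and> n = Inl v \<and> v \<noteq> r) \<or> (\<exists>k v. m = Some k \<and> n = Inl v) \<or> (\<exists>k. m = Some k \<and> n = Inr False)")
    case True
    then show ?thesis
      using base cone apex by (auto simp: Some p base_vertex_def cone_vertex_def apex_def)
  next
    case False
    then show ?thesis
      by (intro unused) (auto simp: Some p base_vertex_def cone_vertex_def apex_def base_map_def susp_map_def
          split: option.splits sum.splits)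
  qed
qed (use None in simp)

lemma distinct_vertices [simp]:
  "cone_vertex k v \<noteq> None" "apex k \<noteq> None" "cone_vertex k v \<noteq> base_vertex v0 v'" "apex k \<noteq> base_vertex v0 v'"
  "cone_vertex k v \<noteq> apex k'" "base_vertex v0 v = None \<longleftrightarrow> v = v0"
  "cone_vertex k v = cone_vertex k' v' \<longleftrightarrow> k = k' \<and> v = v'" "apex k = apex k' \<longleftrightarrow> k = k'"
  "base_vertex v0 v = base_vertex v0 w \<longleftrightarrow> v = w"
  "base_vertex v0 v \<noteq> cone_vertex k v'" "base_vertex v0 v' \<noteq> apex k" "apex k' \<noteq> cone_vertex k v"
  "None \<noteq> cone_vertex k v" "None \<noteq> apex k" "None = base_vertex v0 v \<longleftrightarrow> v = v0"
  by (auto simp: cone_vertex_def apex_def base_vertex_def)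

lemma inj_vertices: "inj_on (base_vertex v0) S" "inj_on (cone_vertex k) S"
  by (auto intro: inj_onI)

lemma vertex_images [simp]:
  "None \<notin> cone_vertex k ` \<sigma>" "apex k' \<notin> cone_vertex k ` \<sigma>" "base_vertex v0 v \<notin> cone_vertex k ` \<sigma>"
  "cone_vertex k v \<in> cone_vertex k' ` \<sigma> \<longleftrightarrow> k = k' \<and> v \<in> \<sigma>"
  "None \<in> base_vertex v0 ` \<sigma> \<longleftrightarrow> v0 \<in> \<sigma>" "apex k \<notin> base_vertex v0 ` \<sigma>"
  "cone_vertex k v \<notin> base_vertex v0 ` \<sigma>" "base_vertex v0 v \<in> base_vertex v0 ` \<sigma> \<longleftrightarrow> v \<in> \<sigma>"
  by (auto simp: image_iff)

lemma susp_map_base [simp]: "v \<noteq> v0 \<Longrightarrow> susp_map k x t (base_vertex v0 v) = 0"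
  by (simp add: susp_map_def base_vertex_def)

text \<open>Over a point of \<open>L k\<close> the suspension is a path from pole to pole, and its
  height is recovered from the difference \<open>1 - 2 * t\<close> of the coordinates at the wedge
  point and at the apex. At height 0 all mass sits at the wedge point, which is the vertex
  \<open>v0\<close> of the base; hence the constant attaching map.\<close>

theorem susp_wedge_cone_attachment:
  fixes A :: "'v set set" and L :: "'v \<Rightarrow> 'v set set"
  assumes I: "finite I" and A: "finite A" "{v0} \<in> A"
    and L: "\<And>k. k \<in> I \<Longrightarrow> finite (L k)" "\<And>k. k \<in> I \<Longrightarrow> {} \<in> L k"
  shows "cone_attachment (bary A) I (\<lambda>k. bary (L k)) (\<lambda>_ _ v. of_bool (v = v0)) (bary (susp_wedge_cx A v0 I L))
    (base_map v0) susp_map (\<lambda>k w. of_bool (w = apex k))"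
proof
  let ?e = "\<lambda>v. of_bool (v = v0) :: real"
  have e: "?e \<in> bary A" using A(2) by (rule vertex_in_bary)
  show "Hausdorff_space (euclidean :: (('v option \<times> ('v + bool)) option \<Rightarrow> real) topology)"
    by (rule Hausdorff_euclidean_fun)
  show "finite I" by fact
  show "compact (bary A)" using A(1) by (rule compact_bary)
  show "compact (bary (L k))" if "k \<in> I" for k
    using L(1)[OF that] by (rule compact_bary)
  show "continuous_on (bary (L k)) (\<lambda>_. ?e)" for k by simp
  show "?e \<in> bary A" by (fact e)
  have coord: "continuous_on S (\<lambda>x :: 'v \<Rightarrow> real. x v)" for S v
    by (rule continuous_on_product_then_coordinatewise[OF continuous_on_id])
  show "continuous_on (bary A) (base_map v0)"
  proof (rule continuous_on_coordinatewise_then_product)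
    show "continuous_on (bary A) (\<lambda>x. base_map v0 x w)" for w
      by (cases w rule: vertex_cases[where r = v0]) (simp_all add: coord)
  qed
  show "continuous_on (bary (L k) \<times> {0..1}) (\<lambda>(x, t). susp_map k x t)" for k
    unfolding case_prod_unfold
  proof (rule continuous_on_coordinatewise_then_product)
    show "continuous_on (bary (L k) \<times> {0..1}) (\<lambda>s. susp_map k (fst s) (snd s) w)" for w
    proof (cases w rule: vertex_cases[where r = v0])
      case (cone k' v)
      then show ?thesis
        by (cases "k' = k") (simp_all, intro continuous_intros continuous_on_coord_fst)
    next
      case (apex k')
      then show ?thesis
        by (cases "k' = k") (simp_all, intro continuous_intros)
    qed (simp_all, intro continuous_intros)
  qed
  show "susp_map k x 0 = base_map v0 ?e" for k :: 'v and x
  proof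
    show "susp_map k x 0 w = base_map v0 ?e w" for w
      by (cases w rule: vertex_cases[where r = v0]) auto
  qed
  show "susp_map k x 1 = (\<lambda>w. of_bool (w = apex k))" for k :: 'v and x
  proof
    show "susp_map k x 1 w = of_bool (w = apex k)" for w :: "('v option \<times> ('v + bool)) option"
      by (cases w rule: vertex_cases[where r = v0]) auto
  qed
  show "inj_on (base_map v0) (bary A)"
  proof (rule inj_onI)
    fix x y assume "base_map v0 x = base_map v0 y"
    then have "base_map v0 x (base_vertex v0 v) = base_map v0 y (base_vertex v0 v)" for v by (rule fun_cong)
    then show "x = y" by auto
  qed
  show "(\<lambda>w. of_bool (w = apex k)) \<noteq> base_map v0 b" for k :: 'v and b
  proof
    assume "(\<lambda>w. of_bool (w = apex k)) = base_map v0 b"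
    from fun_cong[OF this, of "apex k"] show False by simp
  qed
  show "t = 0" if "x \<in> bary (L k)" "t \<in> {0..1}" "susp_map k x t = base_map v0 b" for k x t b
  proof -
    \<comment> \<open>A base point has no mass on cone vertices, so a positive coordinate of
      \<open>x\<close> forces the height to be 0 or 1; the coordinate at the apex rules out
      1.\<close>
    from that(1) obtain v where v: "x v > 0" by (rule bary_pos)
    show ?thesis
      using fun_cong[OF that(3), of "cone_vertex k v"] fun_cong[OF that(3), of "apex k"] v that(2)
      by (simp add: min_def split: if_splits)
  qed
  show "inj_on (\<lambda>k w. of_bool (w = apex k) :: real) I"
  proof (rule inj_onI)
    fix k k' :: 'v assume "(\<lambda>w. of_bool (w = apex k) :: real) = (\<lambda>w. of_bool (w = apex k'))"
    from fun_cong[OF this, of "apex k"] show "k = k'" by (simp split: if_splits)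
  qed
  show "k = k' \<and> t = 1" if "t \<in> {0..1}" "susp_map k x t = (\<lambda>w. of_bool (w = apex k'))" for k x t k'
    using fun_cong[OF that(2), of "apex k'"] that(1) by (simp split: if_splits)
  show "k = k' \<and> x = x' \<and> t = t'"
    if k: "k \<in> I" "x \<in> bary (L k)" "t \<in> {0<..<1}" "k' \<in> I" "x' \<in> bary (L k')" "t' \<in> {0<..<1}"
      and eq: "susp_map k x t = susp_map k' x' t'" for k x t k' x' t'
  proof -
    obtain v where v: "x v > 0" using k(2) by (rule bary_pos)
    have "k = k'"
    proof (rule ccontr)
      assume "k \<noteq> k'"
      then show False using fun_cong[OF eq, of "cone_vertex k v"] v k(3) by (auto simp: min_def split: if_splits)
    qed
    moreover have "t = t'"
      using fun_cong[OF eq, of None] fun_cong[OF eq, of "apex k"] \<open>k = k'\<close> by (simp add: max_def split: if_splits)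
    moreover have "min (2 * t') (2 - 2 * t') \<noteq> 0" using k(6) by (simp add: min_def)
    then have "x v = x' v" for v
      using fun_cong[OF eq, of "cone_vertex k v"] \<open>k = k'\<close> \<open>t = t'\<close> by simp
    ultimately show ?thesis by auto
  qed
  show "bary (susp_wedge_cx A v0 I L) = base_map v0 ` bary A \<union>
    (\<Union>k\<in>I. insert (\<lambda>w. of_bool (w = apex k)) (\<Union>x\<in>bary (L k). susp_map k x ` {0..1}))" (is "_ = ?R")
  proof (intro equalityI subsetI)
    fix g assume "g \<in> bary (susp_wedge_cx A v0 I L)"
    then obtain \<tau> where \<tau>: "\<And>w. 0 \<le> g w" "\<tau> \<in> susp_wedge_cx A v0 I L" "finite \<tau>"
      "\<And>w. w \<notin> \<tau> \<Longrightarrow> g w = 0" "sum g \<tau> = 1"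
      unfolding bary_def by blast
    have pt: "g \<in> ?R" if "\<And>w. w \<noteq> None \<Longrightarrow> g w = 0" "g None = 1"
    proof -
      have "g w = base_map v0 ?e w" for w
        using that(1)[of w] that(2) by (cases w rule: vertex_cases[where r = v0]) auto
      then have "g = base_map v0 ?e" by blast
      then show ?thesis using e by blast
    qed
    have cone: "g \<in> ?R" if k: "k \<in> I" "\<sigma> \<in> L k" "finite \<sigma>"
      and g0: "\<And>w. w \<noteq> None \<Longrightarrow> w \<noteq> apex k \<Longrightarrow> w \<notin> cone_vertex k ` \<sigma> \<Longrightarrow> g w = 0"
      and pq: "g None = 0 \<or> g (apex k) = 0"
      and sum: "g None + g (apex k) + (\<Sum>v\<in>\<sigma>. g (cone_vertex k v)) = 1" for k \<sigma>
    proof -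
      \<comment> \<open>The masses at the wedge point, at the apex and on \<open>L k\<close>. The
        two poles share no simplex, so \<open>p\<close> or \<open>q\<close> vanishes.\<close>
      define p q s where "p = g None" and "q = g (apex k)" and "s = (\<Sum>v\<in>\<sigma>. g (cone_vertex k v))"
      have nn: "p \<ge> 0" "q \<ge> 0" "s \<ge> 0" "p + q + s = 1" "p = 0 \<or> q = 0"
        using \<tau>(1) sum pq by (auto simp: p_def q_def s_def intro: sum_nonneg)
      show ?thesis
      proof (cases "s = 0")
        case True
        then have c0: "g (cone_vertex k v) = 0" if "v \<in> \<sigma>" for v
          using k(3) \<tau>(1) that by (simp add: s_def sum_nonneg_eq_0_iff)
        have g0': "g w = 0" if "w \<noteq> None" "w \<noteq> apex k" for w
          using g0[OF that] c0 by (cases "w \<in> cone_vertex k ` \<sigma>") auto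
        show ?thesis
        proof (cases "p = 0")
          case True
          then have "g w = of_bool (w = apex k)" for w
            using g0'[of w] nn \<open>s = 0\<close> by (cases "w = None") (auto simp: p_def q_def)
          then have "g = (\<lambda>w. of_bool (w = apex k))" by blast
          then show ?thesis using k(1) by blast
        next
          case False
          then have "q = 0" "p = 1" using nn True by auto
          show ?thesis
          proof (rule pt)
            show "g w = 0" if "w \<noteq> None" for w
              using g0'[OF that] \<open>q = 0\<close> by (cases "w = apex k") (simp_all add: q_def)
          qed (use \<open>p = 1\<close> in \<open>simp add: p_def\<close>)
        qed
      next
        case False
        define x where "x v = g (cone_vertex k v) / s" for v
        \<comment> \<open>This solves \<open>2 * t - 1 = q - p\<close>. As one of \<open>p\<close>
          and \<open>q\<close> is 0, the factor \<open>min (2 * t) (2 - 2 * t)\<close> then equals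
          the mass \<open>s\<close>.\<close>
        define t where "t = (1 - p + q) / 2"
        have "sum x \<sigma> = 1" using False by (simp add: x_def s_def flip: sum_divide_distrib)
        moreover have "x v = 0" if "v \<notin> \<sigma>" for v
          using g0[of "cone_vertex k v"] that by (auto simp: x_def)
        ultimately have "x \<in> bary (L k)"
          using k(2,3) \<tau>(1) nn by (intro baryI[where \<sigma> = \<sigma>]) (auto simp: x_def)
        moreover have "t \<in> {0..1}" using nn by (auto simp: t_def)
        moreover have diff: "1 - 2 * t = p - q" "2 * t - 1 = q - p" "min (2 * t) (2 - 2 * t) = s"
          using nn by (auto simp: t_def field_simps min_def)
        have "g w = susp_map k x t w" for w
        proof (cases w rule: vertex_cases[where r = v0])
          case None
          then show ?thesis using nn diff by (auto simp: p_def[symmetric])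
        next
          case (base v)
          then show ?thesis using g0[of w] by simp
        next
          case (cone k' v)
          then show ?thesis using g0[of w] False diff by (auto simp: x_def)
        next
          case (apex k')
          then show ?thesis using nn g0[of w] diff by (auto simp: q_def[symmetric])
        next
          case unused
          then show ?thesis using g0[of w] by (auto simp: image_iff)
        qed
        then have "g = susp_map k x t" by blast
        ultimately show ?thesis using k(1) by blast
      qed
    qed
    consider "\<tau> = {}" | "\<tau> = {None}" | \<sigma> where "\<sigma> \<in> A" "\<tau> = base_vertex v0 ` \<sigma>"
      | k \<sigma> where "k \<in> I" "\<sigma> \<in> L k" "\<tau> = cone_vertex k ` \<sigma> \<or> \<tau> = insert None (cone_vertex k ` \<sigma>) \<or> \<tau> = insert (apex k) (cone_vertex k ` \<sigma>)"
      using \<tau>(2) unfolding susp_wedge_cx_eq by blast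
    then show "g \<in> ?R"
    proof cases
      case 1
      then show ?thesis using \<tau>(5) by simp
    next
      case 2
      show ?thesis
      proof (rule pt)
        show "g w = 0" if "w \<noteq> None" for w
          using \<tau>(4)[of w] that 2 by simp
        show "g None = 1" using \<tau>(5) 2 by simp
      qed
    next
      case (3 \<sigma>)
      define x where "x v = g (base_vertex v0 v)" for v
      have "finite \<sigma>"
        using \<tau>(3) unfolding 3(2) by (rule finite_imageD) (rule inj_vertices)
      moreover have "sum x \<sigma> = 1"
        using \<tau>(5) unfolding 3(2) sum.reindex[OF inj_vertices(1)] by (simp add: x_def)
      moreover have "x v = 0" if "v \<notin> \<sigma>" for v
        using \<tau>(4)[of "base_vertex v0 v"] that 3(2) by (auto simp: x_def)
      ultimately have "x \<in> bary A"
        using 3(1) \<tau>(1) by (intro baryI[where \<sigma> = \<sigma>]) (auto simp: x_def)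
      moreover have "g w = base_map v0 x w" for w
      proof (cases w rule: vertex_cases[where r = v0])
        case None
        then show ?thesis by (simp add: x_def base_vertex_def)
      next
        case (base v)
        then show ?thesis by (simp add: x_def)
      qed (use \<tau>(4)[of w] 3(2) in \<open>auto simp: image_iff\<close>)
      then have "g = base_map v0 x" by blast
      ultimately show ?thesis by blast
    next
      case (4 k \<sigma>)
      have "finite (cone_vertex k ` \<sigma>)" using \<tau>(3) 4(3) by auto
      then have fin: "finite \<sigma>" by (rule finite_imageD) (rule inj_vertices)
      show ?thesis
      proof (rule cone[OF 4(1,2) fin])
        show "g w = 0" if "w \<noteq> None" "w \<noteq> apex k" "w \<notin> cone_vertex k ` \<sigma>" for w
          using \<tau>(4)[of w] that 4(3) by auto
        show "g None = 0 \<or> g (apex k) = 0"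
          using \<tau>(4)[of None] \<tau>(4)[of "apex k"] 4(3) by auto
        show "g None + g (apex k) + (\<Sum>v\<in>\<sigma>. g (cone_vertex k v)) = 1"
        proof -
          have "(\<Sum>v\<in>\<sigma>. g (cone_vertex k v)) = sum g (cone_vertex k ` \<sigma>)"
            by (simp add: sum.reindex[OF inj_vertices(2)])
          then show ?thesis
            using \<tau>(4)[of None] \<tau>(4)[of "apex k"] \<tau>(5) 4(3) fin by auto
        qed
      qed
    qed
  next
    fix g assume "g \<in> ?R"
    then consider x where "x \<in> bary A" "g = base_map v0 x" | k where "k \<in> I" "g = (\<lambda>w. of_bool (w = apex k))"
      | k x t where "k \<in> I" "x \<in> bary (L k)" "t \<in> {0..1}" "g = susp_map k x t"
      by blast
    then show "g \<in> bary (susp_wedge_cx A v0 I L)"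
    proof cases
      case (1 x)
      then obtain \<sigma> where \<sigma>: "\<And>v. 0 \<le> x v" "\<sigma> \<in> A" "finite \<sigma>" "\<And>v. v \<notin> \<sigma> \<Longrightarrow> x v = 0" "sum x \<sigma> = 1"
        unfolding bary_def by blast
      show ?thesis
      proof (rule baryI[where \<sigma> = "base_vertex v0 ` \<sigma>"])
        show "0 \<le> g w" for w
          using \<sigma>(1) 1(2) by (cases w rule: vertex_cases[where r = v0]) auto
        show "g w = 0" if "w \<notin> base_vertex v0 ` \<sigma>" for w
          using that 1(2) \<sigma>(4)
        proof (cases w rule: vertex_cases[where r = v0])
          case None
          then have "v0 \<notin> \<sigma>" using that by simp
          then show ?thesis using 1(2) \<sigma>(4) None by simp
        qed (auto simp: image_iff)
        show "sum g (base_vertex v0 ` \<sigma>) = 1"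
          unfolding sum.reindex[OF inj_vertices(1)] using \<sigma>(5) 1(2) by simp
      qed (use \<sigma> in \<open>auto simp: susp_wedge_cx_eq\<close>)
    next
      case (2 k)
      then have "{apex k} \<in> susp_wedge_cx A v0 I L"
        using L(2)[of k] unfolding susp_wedge_cx_eq by force
      then show ?thesis unfolding 2 by (rule vertex_in_bary)
    next
      case (3 k x t)
      then obtain \<sigma> where \<sigma>: "\<And>v. 0 \<le> x v" "\<sigma> \<in> L k" "finite \<sigma>" "\<And>v. v \<notin> \<sigma> \<Longrightarrow> x v = 0" "sum x \<sigma> = 1"
        unfolding bary_def by blast
      \<comment> \<open>The pole that carries the mass \<open>1 - min (2 * t) (2 - 2 * t)\<close>
        left over by the cone vertices; the other pole has mass 0.\<close>
      define z where "z = (if t \<le> 1/2 then None else apex k)"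
      have z: "z \<notin> cone_vertex k ` \<sigma>" by (simp add: z_def)
      have m: "0 \<le> min (2 * t) (2 - 2 * t)" using 3(3) by simp
      show ?thesis
      proof (rule baryI[where \<sigma> = "insert z (cone_vertex k ` \<sigma>)"])
        show "0 \<le> g w" for w
          using \<sigma>(1) 3(4) m by (cases w rule: vertex_cases[where r = v0]) auto
        show "g w = 0" if "w \<notin> insert z (cone_vertex k ` \<sigma>)" for w
          using that 3(4) \<sigma>(4)
          by (cases w rule: vertex_cases[where r = v0]) (auto simp: z_def image_iff split: if_splits)
        have "sum g (cone_vertex k ` \<sigma>) = (\<Sum>v\<in>\<sigma>. min (2 * t) (2 - 2 * t) * x v)"
          unfolding sum.reindex[OF inj_vertices(2)] using 3(4) by simp
        also have "\<dots> = min (2 * t) (2 - 2 * t)"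
          using \<sigma>(5) by (simp flip: sum_distrib_left)
        finally have "sum g (cone_vertex k ` \<sigma>) = min (2 * t) (2 - 2 * t)" .
        moreover have "g z = 1 - min (2 * t) (2 - 2 * t)"
          using 3(4) by (auto simp: z_def)
        ultimately show "sum g (insert z (cone_vertex k ` \<sigma>)) = 1"
          using \<sigma>(3) z by simp
        show "insert z (cone_vertex k ` \<sigma>) \<in> susp_wedge_cx A v0 I L"
          using 3(1) \<sigma>(2) unfolding susp_wedge_cx_eq z_def by auto
      qed (use \<sigma>(3) in simp)
    qed
  qed
qed

section \<open>Independence complexes\<close>

lemma ind_cx_cone_decomposition:
  assumes symE: "\<And>x y. E x y \<Longrightarrow> E y x" and irrE: "\<And>x. \<not> E x x" and KV: "K \<subseteq> V"
    and complete: "\<And>x y. x \<in> K \<Longrightarrow> y \<in> K \<Longrightarrow> x \<noteq> y \<Longrightarrow> E x y"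
  shows "ind_cx V E = ind_cx (V - K) E \<union> (\<Union>k\<in>K. insert k ` ind_cx (V - (K \<union> nbhd V E k)) E)"
proof (intro equalityI subsetI)
  fix \<tau> assume \<tau>: "\<tau> \<in> ind_cx V E"
  show "\<tau> \<in> ind_cx (V - K) E \<union> (\<Union>k\<in>K. insert k ` ind_cx (V - (K \<union> nbhd V E k)) E)"
  proof (cases "\<tau> \<inter> K = {}")
    case True
    then show ?thesis using \<tau> by (auto simp: ind_cx_def)
  next
    case False
    then obtain k where k: "k \<in> \<tau>" "k \<in> K" by blast
    have "v \<in> V - (K \<union> nbhd V E k)" if "v \<in> \<tau> - {k}" for v
      using that \<tau> k complete[of k v] by (auto simp: ind_cx_def nbhd_def)
    then have "\<tau> - {k} \<in> ind_cx (V - (K \<union> nbhd V E k)) E"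
      using \<tau> unfolding ind_cx_def by blast
    moreover have "\<tau> = insert k (\<tau> - {k})" using k(1) by blast
    ultimately show ?thesis using k(2) by blast
  qed
next
  fix \<tau> assume "\<tau> \<in> ind_cx (V - K) E \<union> (\<Union>k\<in>K. insert k ` ind_cx (V - (K \<union> nbhd V E k)) E)"
  then consider "\<tau> \<in> ind_cx (V - K) E" | k \<sigma> where "k \<in> K" "\<sigma> \<in> ind_cx (V - (K \<union> nbhd V E k)) E" "\<tau> = insert k \<sigma>"
    by blast
  then show "\<tau> \<in> ind_cx V E"
  proof cases
    case 1
    then show ?thesis by (auto simp: ind_cx_def)
  next
    case (2 k \<sigma>)
    have sub: "\<sigma> \<subseteq> V - (K \<union> nbhd V E k)" and ind: "\<And>x y. x \<in> \<sigma> \<Longrightarrow> y \<in> \<sigma> \<Longrightarrow> \<not> E x y"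
      using 2(2) by (auto simp: ind_cx_def)
    have "\<not> E k v \<and> \<not> E v k" if "v \<in> \<sigma>" for v
      using sub that symE[of v k] by (auto simp: nbhd_def)
    then show ?thesis
      using sub ind irrE 2(1,3) KV unfolding ind_cx_def by auto
  qed
qed

text \<open>This keeps the empty simplex in \<open>L k\<close> when \<open>\<G>k k\<close> is
  removed, and with it the vertex \<open>k\<close> as the apex of the remaining cone.\<close>

lemma empty_not_facet:
  assumes "facet (ind_cx W E) \<sigma>" "W \<noteq> {}" "\<And>x. \<not> E x x"
  shows "\<sigma> \<noteq> {}"
proof
  assume "\<sigma> = {}"
  obtain w where "w \<in> W" using assms(2) by blast
  then have "{w} \<in> ind_cx W E" using assms(3) by (simp add: ind_cx_def)
  then have "{w} = {}" using assms(1) unfolding facet_def \<open>\<sigma> = {}\<close> by blast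
  then show False by simp
qed

lemma finite_ind_cx: "finite W \<Longrightarrow> finite (ind_cx W E)"
  by (rule finite_subset[of _ "Pow W"]) (auto simp: ind_cx_def)

theorem theorem3p11:
  fixes V K :: "'a set" and E :: "'a \<Rightarrow> 'a \<Rightarrow> bool" and \<G> :: "'a set set"
  assumes finV: "finite V"
    and symE: "\<And>x y. E x y \<Longrightarrow> E y x"
    and irrE: "\<And>x. \<not> E x x"
    and KV: "K \<subseteq> V"
    and Kcomplete: "\<And>x y. x \<in> K \<Longrightarrow> y \<in> K \<Longrightarrow> x \<noteq> y \<Longrightarrow> E x y"
    and genG: "generating_faces (ind_cx (V - K) E) \<G>"
    and adjG: "\<And>k \<sigma>. k \<in> K \<Longrightarrow> \<sigma> \<in> \<G> \<Longrightarrow> \<exists>v\<in>\<sigma>. E v k"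
  shows "(\<exists>b. (\<forall>i\<in>insert None (Some ` K).
                 {b i} \<in> (case i of None \<Rightarrow> (\<lambda>\<sigma>. Inl ` \<sigma>) ` ind_cx (V - K) E
                          | Some k \<Rightarrow> susp_cx (ind_cx (V - (K \<union> nbhd V E k)) E))) \<and>
           realization (ind_cx V E) homotopy_equivalent_space
           realization (wedge_cx (insert None (Some ` K))
              (\<lambda>i. case i of None \<Rightarrow> (\<lambda>\<sigma>. Inl ` \<sigma>) ` ind_cx (V - K) E
                   | Some k \<Rightarrow> susp_cx (ind_cx (V - (K \<union> nbhd V E k)) E)) b))
    \<and> (\<forall>\<G>k :: 'a \<Rightarrow> 'a set set.
         (\<forall>k\<in>{k\<in>K. V - (K \<union> nbhd V E k) \<noteq> {}}.
             generating_faces (ind_cx (V - (K \<union> nbhd V E k)) E) (\<G>k k)) \<longrightarrow>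
         generating_faces (ind_cx V E)
           (\<G> \<union> (\<Union>k\<in>{k\<in>K. V - (K \<union> nbhd V E k) = {}}. {{k}})
              \<union> (\<Union>k\<in>{k\<in>K. V - (K \<union> nbhd V E k) \<noteq> {}}. {insert k \<sigma> | \<sigma>. \<sigma> \<in> \<G>k k})))"
proof -
  define A where "A = ind_cx (V - K) E"
  define L where "L k = ind_cx (V - (K \<union> nbhd V E k)) E" for k
  have finK: "finite K" using finV KV by (rule rev_finite_subset)
  have finA: "finite A" "finite (A - \<G>)" and finL: "finite (L k)" for k
    using finV by (simp_all add: A_def L_def finite_ind_cx)
  have AK: "\<sigma> \<inter> K = {}" if "\<sigma> \<in> A" for \<sigma>
    using that by (auto simp: A_def ind_cx_def)
  have LA: "L k \<subseteq> A - \<G>" if "k \<in> K" for k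
  proof
    fix \<sigma> assume \<sigma>: "\<sigma> \<in> L k"
    then have "\<sigma> \<in> A" by (auto simp: A_def L_def ind_cx_def)
    moreover have "\<sigma> \<notin> \<G>"
      using adjG[OF that, of \<sigma>] \<sigma> symE by (fastforce simp: L_def ind_cx_def nbhd_def)
    ultimately show "\<sigma> \<in> A - \<G>" by blast
  qed
  have L_empty: "{} \<in> L k" for k by (simp add: L_def ind_cx_def)
  have LK: "k' \<notin> \<sigma>" if "k' \<in> K" "\<sigma> \<in> L k" for k k' \<sigma>
    using that by (auto simp: L_def ind_cx_def)
  have decomp: "ind_cx V E = A \<union> (\<Union>k\<in>K. insert k ` L k)"
    unfolding A_def L_def using symE irrE KV Kcomplete by (rule ind_cx_cone_decomposition)
  have facetG: "facet A \<sigma>" if "\<sigma> \<in> \<G>" for \<sigma>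
    using genG that by (simp add: generating_faces_def A_def)
  have contr: "contractible (bary (A - \<G>))" and ne: "bary (A - \<G>) \<noteq> {}"
    using genG by (simp_all add: generating_faces_def A_def realization_bary)
  \<comment> \<open>The wedge point must be a vertex of \<open>A - \<G>\<close>, where the
    contraction takes place. Any vertex of a remaining simplex will do: a singleton in
    \<open>\<G>\<close> is a facet, so it equals every simplex that contains its vertex.\<close>
  obtain v0 where v0: "{v0} \<in> A - \<G>"
  proof -
    obtain x where "x \<in> bary (A - \<G>)" using ne by blast
    then obtain \<sigma> where \<sigma>: "\<sigma> \<in> A - \<G>" "sum x \<sigma> = 1" unfolding bary_def by blast
    then obtain v where v: "v \<in> \<sigma>" by (metis all_not_in_conv sum.empty zero_neq_one)
    have vA: "{v} \<in> A" using \<sigma>(1) v by (auto simp: A_def ind_cx_def)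
    moreover have "{v} \<notin> \<G>"
    proof
      assume "{v} \<in> \<G>"
      then have "\<sigma> = {v}" using facetG[of "{v}"] \<sigma>(1) v unfolding facet_def by blast
      then show False using \<sigma>(1) \<open>{v} \<in> \<G>\<close> by blast
    qed
    ultimately show thesis using that by blast
  qed
  define e where "e = (\<lambda>v. of_bool (v = v0) :: real)"
  have e: "e \<in> bary (A - \<G>)" unfolding e_def using v0 by (rule vertex_in_bary)
  obtain H where H: "continuous_on ({0..1::real} \<times> bary (A - \<G>)) H"
    "H \<in> {0..1} \<times> bary (A - \<G>) \<rightarrow> bary (A - \<G>)" "\<And>x. H (0, x) = x" "\<And>x. H (1, x) = e"
    using contractible_homotopy[OF contr e] by blast
  have bary_L: "bary (L k) \<subseteq> bary (A - \<G>)" if "k \<in> K" for k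
    using LA[OF that] by (rule bary_mono)
  have bary_A: "bary (A - \<G>) \<subseteq> bary A" by (rule bary_mono) blast

  \<comment> \<open>Base and cone bottoms agree in \<open>X\<close> and \<open>W\<close>; only the
    attaching maps differ, the inclusion here and the constant \<open>e\<close> there. The
    contraction \<open>H\<close> joins the two.\<close>
  have X: "cone_attachment (bary A) K (\<lambda>k. bary (L k)) (\<lambda>k x. x) (bary (ind_cx V E))
    (\<lambda>x. x) (\<lambda>k x t v. (1 - t) * x v + t * of_bool (v = k)) (\<lambda>k v. of_bool (v = k))"
    unfolding decomp using finK finA(1) AK LA L_empty by (intro bary_cone_attachment) blast+
  have W: "cone_attachment (bary A) K (\<lambda>k. bary (L k)) (\<lambda>_ _. e) (bary (susp_wedge_cx A v0 K L))
    (base_map v0) susp_map (\<lambda>k w. of_bool (w = apex k))"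
    unfolding e_def using finK finA(1) finL v0 L_empty by (intro susp_wedge_cone_attachment) blast+
  have "top_of_set (bary (ind_cx V E)) homotopy_equivalent_space top_of_set (bary (susp_wedge_cx A v0 K L))"
  proof (rule cone_attachment_homotopy_equivalent[OF X W, where h = "\<lambda>_ x t. H (t, x)"])
    show "continuous_on (bary (L k) \<times> {0..1}) (\<lambda>(x, t). H (t, x))" if "k \<in> K" for k
    proof -
      have "continuous_on (bary (L k) \<times> {0..1}) (\<lambda>s. H (snd s, fst s))"
        using bary_L[OF that] by (intro continuous_on_compose2[OF H(1)] continuous_intros) auto
      then show ?thesis by (simp add: case_prod_unfold)
    qed
    show "H (t, x) \<in> bary A" if "k \<in> K" "x \<in> bary (L k)" "t \<in> {0..1}" for k x t
      using H(2) that bary_L[OF that(1)] bary_A by blast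
  qed (simp_all add: H)
  then have equiv: "realization (ind_cx V E) homotopy_equivalent_space realization (susp_wedge_cx A v0 K L)"
    by (simp add: realization_bary)
  have base: "\<forall>i\<in>insert None (Some ` K). {case i of None \<Rightarrow> Inl v0 | Some k \<Rightarrow> Inr True} \<in>
      (case i of None \<Rightarrow> (\<lambda>\<sigma>. Inl ` \<sigma>) ` A | Some k \<Rightarrow> susp_cx (L k))"
  proof -
    have "{Inl v0} \<in> (\<lambda>\<sigma>. Inl ` \<sigma>) ` A"
      using v0 by (intro image_eqI[of _ _ "{v0}"]) auto
    moreover have "{Inr True} \<in> susp_cx (L k)" for k
      unfolding susp_cx_def using L_empty[of k] by blast
    ultimately show ?thesis by simp
  qed

  have gen: "generating_faces (ind_cx V E)
      (\<G> \<union> (\<Union>k\<in>{k\<in>K. V - (K \<union> nbhd V E k) = {}}. {{k}})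
        \<union> (\<Union>k\<in>{k\<in>K. V - (K \<union> nbhd V E k) \<noteq> {}}. {insert k \<sigma> | \<sigma>. \<sigma> \<in> \<G>k k}))" (is "generating_faces _ ?\<Gamma>")
    if hyp: "\<forall>k\<in>{k\<in>K. V - (K \<union> nbhd V E k) \<noteq> {}}. generating_faces (ind_cx (V - (K \<union> nbhd V E k)) E) (\<G>k k)"
    for \<G>k :: "'a \<Rightarrow> 'a set set"
  proof -
    define K' where "K' = {k\<in>K. V - (K \<union> nbhd V E k) \<noteq> {}}"
    have K'K: "K' \<subseteq> K" by (auto simp: K'_def)
    have genL: "generating_faces (L k) (\<G>k k)" if "k \<in> K'" for k
      using hyp that by (simp add: K'_def L_def)
    have facetL: "facet (L k) \<sigma>" if "k \<in> K'" "\<sigma> \<in> \<G>k k" for k \<sigma>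
      using genL[OF that(1)] that(2) by (simp add: generating_faces_def)
    have empty: "{} \<notin> \<G>k k" if "k \<in> K'" for k
      using facetL[OF that, of "{}"] empty_not_facet[of "V - (K \<union> nbhd V E k)" E "{}"] that irrE
      by (auto simp: K'_def L_def)
    \<comment> \<open>For such \<open>k\<close> the simplex \<open>{k}\<close> is all that the cone
      adds to the base, so its removal deletes the cone, and \<open>K'\<close> is the index set of
      what remains.\<close>
    have trivial: "L k = {{}}" if "k \<in> K" "k \<notin> K'" for k
      using that unfolding K'_def L_def ind_cx_def by auto
    have \<Gamma>: "?\<Gamma> = \<G> \<union> (\<lambda>k. {k}) ` (K - K') \<union> (\<Union>k\<in>K'. insert k ` \<G>k k)"
      by (auto simp: K'_def)
    have same: "k = k' \<and> \<sigma> = \<tau>"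
      if "k \<in> K" "k' \<in> K" "\<sigma> \<in> L k" "\<tau> \<in> L k'" "insert k \<sigma> = insert k' \<tau>" for k k' \<sigma> \<tau>
    proof -
      have "k = k'" using that LK by (metis insertCI insertE)
      then show ?thesis using that LK by (metis insert_ident)
    qed
    have GA: "\<G> \<subseteq> A" using facetG by (auto simp: facet_def)
    have GL: "\<G>k k \<subseteq> L k" if "k \<in> K'" for k
      using facetL[OF that] by (auto simp: facet_def)
    \<comment> \<open>What is left is again a base with cones, now indexed by \<open>K'\<close>. A
      simplex that meets \<open>K\<close> determines its vertex in \<open>K\<close> and its residue
      in \<open>L k\<close>, so removing faces from one cone affects neither the base nor another
      cone.\<close>
    have rest: "ind_cx V E - ?\<Gamma> = (A - \<G>) \<union> (\<Union>k\<in>K'. insert k ` (L k - \<G>k k))"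
    proof (intro equalityI subsetI)
      fix \<tau> assume \<tau>: "\<tau> \<in> ind_cx V E - ?\<Gamma>"
      then consider "\<tau> \<in> A" | k \<sigma> where "k \<in> K" "\<sigma> \<in> L k" "\<tau> = insert k \<sigma>"
        unfolding decomp by blast
      then show "\<tau> \<in> (A - \<G>) \<union> (\<Union>k\<in>K'. insert k ` (L k - \<G>k k))"
      proof cases
        case 1
        then show ?thesis using \<tau> by blast
      next
        case (2 k \<sigma>)
        have "k \<in> K'" using 2 \<tau> trivial[of k] unfolding \<Gamma> by auto
        moreover have "\<sigma> \<notin> \<G>k k" using 2 \<tau> \<open>k \<in> K'\<close> unfolding \<Gamma> by blast
        ultimately show ?thesis using 2 by blast
      qed
    next
      fix \<tau> assume "\<tau> \<in> (A - \<G>) \<union> (\<Union>k\<in>K'. insert k ` (L k - \<G>k k))"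
      then consider "\<tau> \<in> A" "\<tau> \<notin> \<G>" | k \<sigma> where "k \<in> K'" "\<sigma> \<in> L k" "\<sigma> \<notin> \<G>k k" "\<tau> = insert k \<sigma>"
        by blast
      then show "\<tau> \<in> ind_cx V E - ?\<Gamma>"
      proof cases
        case 1
        then show ?thesis using AK[OF 1(1)] K'K unfolding decomp \<Gamma> by blast
      next
        case (2 k \<sigma>)
        have "\<tau> \<notin> \<G>" using 2 K'K AK GA by blast
        moreover have "\<tau> \<noteq> {k'}" if "k' \<in> K - K'" for k' using 2(1,4) that by auto
        moreover have "\<tau> \<noteq> insert k' \<sigma>'" if "k' \<in> K'" "\<sigma>' \<in> \<G>k k'" for k' \<sigma>'
          using same[of k k' \<sigma> \<sigma>'] 2 that GL K'K by blast
        ultimately show ?thesis using 2 K'K unfolding decomp \<Gamma> by blast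
      qed
    qed
    \<comment> \<open>A simplex through \<open>k\<close> lies in the cone over \<open>L k\<close>,
      so the maximality of a face through \<open>k\<close> can be tested in
      \<open>L k\<close>.\<close>
    have sup_cases: "\<exists>\<rho>\<in>L k. \<tau> = insert k \<rho>" if "\<tau> \<in> ind_cx V E" "k \<in> \<tau>" "k \<in> K" for \<tau> k
      using that AK LK unfolding decomp by blast
    have facets: "facet (ind_cx V E) \<sigma>" if "\<sigma> \<in> ?\<Gamma>" for \<sigma>
    proof -
      consider "\<sigma> \<in> \<G>" | k where "k \<in> K" "k \<notin> K'" "\<sigma> = {k}" | k \<rho> where "k \<in> K'" "\<rho> \<in> \<G>k k" "\<sigma> = insert k \<rho>"
        using \<open>\<sigma> \<in> ?\<Gamma>\<close> unfolding \<Gamma> by blast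
      then show ?thesis
      proof cases
        case 1
        \<comment> \<open>Every \<open>k\<close> in \<open>K\<close> has a neighbour in \<sigma>, so
          no independent superset of \<sigma> meets \<open>K\<close>, and maximality in
          \<open>A\<close> is enough.\<close>
        have "\<tau> = \<sigma>" if "\<tau> \<in> ind_cx V E" "\<sigma> \<subseteq> \<tau>" for \<tau>
        proof -
          have "\<tau> \<inter> K = {}"
            using adjG[OF _ 1] that unfolding ind_cx_def by blast
          then have "\<tau> \<in> A" using that(1) unfolding decomp by blast
          then show ?thesis using facetG[OF 1] that(2) unfolding facet_def by blast
        qed
        then show ?thesis using GA 1 unfolding facet_def decomp by blast
      next
        case (2 k)
        have "\<tau> = \<sigma>" if "\<tau> \<in> ind_cx V E" "\<sigma> \<subseteq> \<tau>" for \<tau>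
          using sup_cases[OF that(1), of k] that(2) 2 trivial[OF 2(1,2)] by auto
        moreover have "\<sigma> \<in> ind_cx V E" using 2 L_empty unfolding decomp by blast
        ultimately show ?thesis unfolding facet_def by blast
      next
        case (3 k \<rho>)
        have kK: "k \<in> K" using 3(1) K'K by blast
        have \<rho>: "\<rho> \<in> L k" using GL 3 by blast
        have "\<tau> = \<sigma>" if "\<tau> \<in> ind_cx V E" "\<sigma> \<subseteq> \<tau>" for \<tau>
        proof -
          have "\<exists>\<rho>'\<in>L k. \<tau> = insert k \<rho>'"
            using sup_cases[OF that(1), of k] that(2) 3 kK by auto
          then obtain \<rho>' where \<rho>': "\<rho>' \<in> L k" "\<tau> = insert k \<rho>'" by blast
          have "\<rho> \<subseteq> \<rho>'" using that(2) 3(3) \<rho>'(2) LK[OF kK \<rho>] by blast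
          then show ?thesis using facetL[OF 3(1,2)] \<rho>' 3(3) unfolding facet_def by blast
        qed
        moreover have "\<sigma> \<in> ind_cx V E" using 3 kK \<rho> unfolding decomp by blast
        ultimately show ?thesis unfolding facet_def by blast
      qed
    qed
    have X': "cone_attachment (bary (A - \<G>)) K' (\<lambda>k. bary (L k - \<G>k k)) (\<lambda>k x. x) (bary (ind_cx V E - ?\<Gamma>))
      (\<lambda>x. x) (\<lambda>k x t v. (1 - t) * x v + t * of_bool (v = k)) (\<lambda>k v. of_bool (v = k))"
      unfolding rest
    proof (rule bary_cone_attachment)
      show "finite K'" using finK K'K by (rule rev_finite_subset)
      show "finite (A - \<G>)" by (rule finA)
      show "\<sigma> \<inter> K' = {}" if "\<sigma> \<in> A - \<G>" for \<sigma> using AK that K'K by blast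
      show "L k - \<G>k k \<subseteq> A - \<G>" if "k \<in> K'" for k using LA that K'K by blast
      show "{} \<in> L k - \<G>k k" if "k \<in> K'" for k using L_empty empty that by blast
    qed
    have "contractible (bary (ind_cx V E - ?\<Gamma>))"
    proof (rule cone_attachment.contractible_cone_attachment[OF X' contr e])
      show "contractible (bary (L k - \<G>k k))" "bary (L k - \<G>k k) \<noteq> {}" if "k \<in> K'" for k
        using genL[OF that] by (simp_all add: generating_faces_def realization_bary)
    qed
    moreover have "bary (ind_cx V E - ?\<Gamma>) \<noteq> {}"
      using ne unfolding rest bary_Un by blast
    ultimately show ?thesis
      using facets unfolding generating_faces_def realization_bary by simp
  qed
  show ?thesis
  proof (intro conjI allI impI)
    show "\<exists>b. (\<forall>i\<in>insert None (Some ` K).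
                 {b i} \<in> (case i of None \<Rightarrow> (\<lambda>\<sigma>. Inl ` \<sigma>) ` ind_cx (V - K) E
                          | Some k \<Rightarrow> susp_cx (ind_cx (V - (K \<union> nbhd V E k)) E))) \<and>
           realization (ind_cx V E) homotopy_equivalent_space
           realization (wedge_cx (insert None (Some ` K))
              (\<lambda>i. case i of None \<Rightarrow> (\<lambda>\<sigma>. Inl ` \<sigma>) ` ind_cx (V - K) E
                   | Some k \<Rightarrow> susp_cx (ind_cx (V - (K \<union> nbhd V E k)) E)) b)"
      using base equiv[unfolded susp_wedge_cx_def] unfolding A_def L_def by blast
  qed (rule gen)
qed

end
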